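(* Let $n\ge 1$ and let $A\in M_n(\mathbb{Z})$ with $\det A\neq 0$ induce an ergodic endomorphism of the torus $\mathbb{T}^n=\mathbb{R}^n/\mathbb{Z}^n$. Then there exist a constant $C>0$ and a sequence of periodic orbits $\{O_k\}_{k\in\mathbb{N}}$ of $A$ such that $$d(O_k)^n\,T(O_k)\ge C\quad\text{for all }k,\qquad\text{and}\qquad \lim_{k\to+\infty}T(O_k)=+\infty.$$
   Context: For $A\in M_n(\mathbb{Z})$ (integer $n\times n$ matrices) with $\det A\neq 0$, the induced endomorphism of $\mathbb{T}^n$ is $x\mapsto Ax \bmod 1$, also denoted $A$. It is called ergodic if it is ergodic with respect to Lebesgue (Haar) measure Leb on $\mathbb{T}^n$. The metric on $\mathbb{T}^n$ is $d(x,y)=\min\{|\tilde x-\tilde y-m| : m\in\mathbb{Z}^n\}$ for lifts $\tilde x,\tilde y\in\mathbb{R}^n$, with $|\cdot|$ the Euclidean norm. A periodic orbit $O$ is the (finite) forward orbit $\{A^ix\}_{i\ge 0}$ of a point $x$ with $A^mx=x$ for some $m\ge1$; $T(O)$ denotes its period (its cardinality), and $d(O)=\min\{d(x,y): x,y\in O,\ x\neq y\}$. *)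

theory Defs
  imports "HOL-Analysis.Analysis"
begin

text \<open>The torus T^n = R^n / Z^n is represented by the fundamental domain [0,1)^n:
  each point of the torus is identified with its unique representative in [0,1)^n.\<close>

definition unit_cube :: "(real ^ 'n) set" where
  "unit_cube = {x. \<forall>i. 0 \<le> x $ i \<and> x $ i < 1}"

definition tfrac :: "real ^ 'n \<Rightarrow> real ^ 'n" where
  "tfrac x = (\<chi> i. frac (x $ i))"

definition int_vecs :: "(real ^ 'n) set" where
  "int_vecs = {m. \<forall>i. m $ i \<in> \<int>}"

definition real_mat :: "int ^ 'n ^ 'n \<Rightarrow> real ^ 'n ^ 'n" where
  "real_mat A = (\<chi> i j. of_int (A $ i $ j))"

definition tmap :: "int ^ 'n ^ 'n \<Rightarrow> real ^ 'n \<Rightarrow> real ^ 'n" where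
  "tmap A x = tfrac (real_mat A *v x)"

definition ergodic_torus :: "int ^ 'n ^ 'n \<Rightarrow> bool" where
  "ergodic_torus A \<longleftrightarrow>
     (\<forall>E \<in> sets lborel. E \<subseteq> unit_cube \<longrightarrow>
        {x \<in> unit_cube. tmap A x \<in> E} = E \<longrightarrow>
        emeasure lborel E = 0 \<or> emeasure lborel E = 1)"

definition tdist :: "real ^ 'n \<Rightarrow> real ^ 'n \<Rightarrow> real" where
  "tdist x y = Inf {norm (x - y - m) | m. m \<in> int_vecs}"

definition periodic_orbit :: "int ^ 'n ^ 'n \<Rightarrow> (real ^ 'n) set \<Rightarrow> bool" where
  "periodic_orbit A Orb \<longleftrightarrow>
     (\<exists>x \<in> unit_cube. (\<exists>m::nat. m \<ge> 1 \<and> (tmap A ^^ m) x = x) \<and>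
        Orb = {(tmap A ^^ i) x | i. True})"

definition period :: "(real ^ 'n) set \<Rightarrow> nat" where
  "period Orb = card Orb"

definition orbit_dist :: "(real ^ 'n) set \<Rightarrow> real" where
  "orbit_dist Orb = Min {tdist x y | x y. x \<in> Orb \<and> y \<in> Orb \<and> x \<noteq> y}"

end

theory Submission
  imports Defs "HOL-Computational_Algebra.Polynomial" "HOL-Number_Theory.Cong"
begin

text \<open>
  Ergodicity means that no power of \<open>A\<close> fixes a nonzero rational vector. Choose a flag of
  \<open>A\<close>-invariant rational subspaces with irreducible quotients, of dimensions \<open>d\<^sub>i\<close>, and
  distinct primes \<open>p\<^sub>i\<close> modulo which the characteristic polynomial of the \<open>i\<close>-th quotient has a
  simple root. For a large \<open>M\<close> let \<open>p\<^sub>i ^ k\<^sub>i\<close> be comparable to \<open>M ^ d\<^sub>i\<close> and let \<open>v\<^sub>i\<close> be a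
  \<open>p\<^sub>i ^ k\<^sub>i\<close>-torsion point in the \<open>i\<close>-th subspace which is a generalised eigenvector of \<open>A\<close> and
  whose image in the quotient is an eigenvector. The orbit of the sum \<open>v\<close> of the \<open>v\<^sub>i\<close> has period
  of order at least \<open>M ^ n\<close>, because the eigenvalue has order comparable to \<open>p\<^sub>i ^ k\<^sub>i\<close> modulo
  \<open>p\<^sub>i ^ k\<^sub>i\<close>. It is separated by a multiple of \<open>1 / M\<close>: if a lift \<open>l\<close> of a difference of two
  orbit points is nonzero in the top quotient, then some nonzero polynomial \<open>h\<close> of degree less than
  the dimension of that quotient and with coefficients bounded by \<open>M\<close> maps it to an integral vector
  there, nonzero by irreducibility, so \<open>l\<close> has size at least a multiple of \<open>1 / M\<close>. If \<open>l\<close> vanishes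
  in the top quotient, then the contribution of the top \<open>v\<^sub>i\<close> to \<open>l\<close> has bounded denominator, and
  one descends to the next subspace after multiplying by that denominator.
\<close>

section \<open>Integer polynomials modulo prime powers\<close>

text \<open>Differentiate \<open>f = (x - a) * g + f(a)\<close> and evaluate at
  \<open>a\<close>.\<close>

lemma poly_synthetic_div_self:
  fixes f :: "int poly"
  shows "poly (synthetic_div f a) a = poly (pderiv f) a"
proof -
  have "poly (pderiv f) a = poly (pderiv ([:-a, 1:] * synthetic_div f a + [:poly f a:])) a"
    by (simp only: synthetic_div_correct')
  also have "\<dots> = poly (synthetic_div f a) a"
    by (simp only: pderiv_mult pderiv_add pderiv_pCons) simp
  finally show ?thesis ..
qed

lemma poly_taylor_quadratic:
  fixes f :: "int poly"
  obtains r where "poly f (a + h) = poly f a + h * poly (pderiv f) a + h\<^sup>2 * r"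
proof -
  let ?g = "synthetic_div f a"
  have 1: "poly f x = (x - a) * poly ?g x + poly f a" for x
    using arg_cong[OF synthetic_div_correct'[of a f], of "\<lambda>q. poly q x"] by (simp add: algebra_simps)
  have 2: "poly ?g x = (x - a) * poly (synthetic_div ?g a) x + poly ?g a" for x
    using arg_cong[OF synthetic_div_correct'[of a ?g], of "\<lambda>q. poly q x"] by (simp add: algebra_simps)
  show thesis
    by (rule that[of "poly (synthetic_div ?g a) (a + h)"])
      (simp add: 1[of "a + h"] 2[of "a + h"] poly_synthetic_div_self power2_eq_square algebra_simps)
qed

lemma cong_poly:
  fixes f :: "int poly"
  assumes "[a = b] (mod p)"
  shows "[poly f a = poly f b] (mod p)"
  by (induction f) (auto intro!: cong_add cong_mult assms)

text \<open>One Newton step raises the exponent: if \<open>f(a) = p^k * b\<close>, the correction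
  \<open>p^k * t\<close> works once \<open>f'(a) * t = -b\<close> modulo \<open>p\<close>, and
  \<open>f'(a)\<close> stays a unit because \<open>a\<close> does not change modulo
  \<open>p\<close>.\<close>

lemma hensel_lifting:
  fixes f :: "int poly" and p :: int
  assumes "prime p" "p dvd poly f a0" "\<not> p dvd poly (pderiv f) a0"
  shows "\<exists>a. [a = a0] (mod p) \<and> p ^ k dvd poly f a"
proof (induction k)
  case 0
  then show ?case by (auto intro: exI[of _ a0])
next
  case (Suc k)
  show ?case
  \<comment> \<open>The quadratic Taylor term carries \<open>p^(2k)\<close>, which contains
    \<open>p^(k+1)\<close> only for \<open>k \<ge> 1\<close>; exponent 1 is the hypothesis on
    \<open>a0\<close>.\<close>
  proof (cases "k = 0")
    case True
    then show ?thesis using assms by (auto intro: exI[of _ a0])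
  next
    case False
    from Suc obtain a b where a: "[a = a0] (mod p)" "poly f a = p ^ k * b" by (auto simp: dvd_def)
    have "[poly (pderiv f) a = poly (pderiv f) a0] (mod p)"
      using a(1) by (rule cong_poly)
    then have "\<not> p dvd poly (pderiv f) a"
      using assms(3) by (simp add: cong_dvd_iff)
    then have "coprime (poly (pderiv f) a) p"
      using assms(1) by (metis coprime_commute prime_imp_coprime)
    then obtain t where "[poly (pderiv f) a * t = - b] (mod p)"
      by (metis cong_solve_coprime_int cong_scalar_right mult.assoc mult_1)
    then have t: "p dvd b + t * poly (pderiv f) a"
      by (metis add.commute cong_iff_dvd_diff diff_minus_eq_add mult.commute)
    obtain r where r: "poly f (a + p ^ k * t) = poly f a + (p ^ k * t) * poly (pderiv f) a + (p ^ k * t)\<^sup>2 * r"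
      by (rule poly_taylor_quadratic)
    have "poly f (a + p ^ k * t) = p ^ k * (b + t * poly (pderiv f) a) + (p ^ k)\<^sup>2 * (t\<^sup>2 * r)"
      unfolding r a(2) by (simp add: algebra_simps power_mult_distrib)
    moreover have "p ^ Suc k dvd p ^ k * (b + t * poly (pderiv f) a)"
      using t by (simp add: mult.commute mult_dvd_mono)
    moreover have "p ^ Suc k dvd (p ^ k)\<^sup>2"
      unfolding power_mult[symmetric] by (rule le_imp_power_dvd) (use False in simp)
    ultimately have "p ^ Suc k dvd poly f (a + p ^ k * t)"
      by simp
    moreover have "[a + p ^ k * t = a0] (mod p)"
    proof -
      have "p dvd p ^ k * t" using False by (simp add: dvd_power)
      then have "[p ^ k * t = 0] (mod p)" by (simp add: cong_0_iff)
      from cong_add[OF a(1) this] show ?thesis by simp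
    qed
    ultimately show ?thesis by blast
  qed
qed

text \<open>Euclid's argument: with \<open>c = f(0)\<close> and \<open>N = Q!\<close>,
  \<open>f(c * N * y) = c * w\<close> where \<open>w = 1\<close> modulo \<open>N\<close>, so every
  prime factor of \<open>w\<close> exceeds \<open>Q\<close>. All but finitely many \<open>y\<close>
  make \<open>w\<close> different from 1 and -1.\<close>

lemma exists_prime_dvd_poly_value:
  fixes f :: "int poly"
  assumes "degree f > 0" "poly f 0 \<noteq> 0"
  obtains p :: nat and a :: int where "prime p" "p > Q" "int p dvd poly f a"
proof -
  define c where "c = poly f 0"
  define N :: int where "N = fact Q"
  have N: "N \<noteq> 0" by (simp add: N_def)
  have eq: "poly f x = x * poly (synthetic_div f 0) x + c" for x
    using arg_cong[OF synthetic_div_correct'[of 0 f], of "\<lambda>q. poly q x"] by (simp add: c_def)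
  have "f - [:c:] \<noteq> 0" "f - [:-c:] \<noteq> 0" using assms(1) by auto
  then have "finite ({x. poly (f - [:c:]) x = 0} \<union> {x. poly (f - [:-c:]) x = 0})"
    using poly_roots_finite by blast
  moreover have "infinite (range (\<lambda>y::nat. c * N * int y))"
    by (rule range_inj_infinite) (use N assms(2) in \<open>auto simp: inj_def c_def\<close>)
  ultimately have "\<not> range (\<lambda>y::nat. c * N * int y) \<subseteq>
      {x. poly (f - [:c:]) x = 0} \<union> {x. poly (f - [:-c:]) x = 0}"
    using finite_subset by blast
  then obtain y :: nat where "c * N * int y \<notin> {x. poly (f - [:c:]) x = 0} \<union> {x. poly (f - [:-c:]) x = 0}"
    by blast
  then have y: "poly f (c * N * int y) \<noteq> c" "poly f (c * N * int y) \<noteq> - c"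
    by auto
  define w where "w = 1 + N * (int y * poly (synthetic_div f 0) (c * N * int y))"
  have w: "poly f (c * N * int y) = c * w"
    by (subst eq) (simp add: w_def algebra_simps)
  then have "w \<noteq> 1" "w \<noteq> -1" using y by auto
  then have "nat \<bar>w\<bar> \<noteq> 1" by auto
  then obtain p where p: "prime p" "p dvd nat \<bar>w\<bar>" using prime_factor_nat by blast
  then have pw: "int p dvd w" by (metis int_dvd_int_iff dvd_abs_iff int_nat_eq abs_ge_zero)
  have "p > Q"
  proof (rule ccontr)
    assume "\<not> Q < p"
    then have "p dvd fact Q" using p(1) by (simp add: prime_dvd_fact_iff)
    then have "int p dvd N" unfolding N_def by (metis int_dvd_int_iff of_nat_fact)
    then have "int p dvd 1" using pw unfolding w_def by (metis dvd_add_left_iff dvd_mult2)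
    then show False using p(1) by auto
  qed
  moreover have "int p dvd poly f (c * N * int y)" using w pw by simp
  ultimately show thesis using that p(1) by blast
qed

text \<open>If \<open>p\<close> does not divide \<open>m\<close>, the sum of the \<open>b^i\<close>
  for \<open>i < m\<close> is \<open>m\<close> modulo \<open>p\<close>, a unit, so
  \<open>p^k\<close> divides \<open>b - 1\<close> and \<open>k < c\<close>. Otherwise one factor
  \<open>p\<close> is removed from \<open>m\<close> and from \<open>p^k\<close> together.\<close>

lemma lifting_the_exponent_dvd:
  fixes b p :: int
  assumes p: "prime p" "odd p" and b: "p dvd b - 1" "\<not> p ^ c dvd b - 1"
  shows "p ^ k dvd b ^ m - 1 \<Longrightarrow> p ^ (k - c) dvd int m"
proof (induction m arbitrary: k rule: less_induct)
  case (less m)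
  have p1: "\<bar>p\<bar> > 1" using p(1) prime_gt_1_int by force
  have b1: "[b = 1] (mod p)" using b(1) by (simp add: cong_iff_dvd_diff)
  show ?case
  proof (cases "m = 0 \<or> k = 0")
    case True
    then show ?thesis by auto
  next
    case False
    show ?thesis
    proof (cases "p dvd int m")
      case pm: False
      have "[(\<Sum>i<m. b ^ i) = (\<Sum>i<m. 1 ^ i)] (mod p)"
        by (intro cong_sum cong_pow b1)
      then have "\<not> p dvd (\<Sum>i<m. b ^ i)" using pm by (simp add: cong_dvd_iff)
      then have "coprime (p ^ k) (\<Sum>i<m. b ^ i)"
        using p(1) by (simp add: prime_imp_coprime)
      moreover have "b ^ m - 1 = (b - 1) * (\<Sum>i<m. b ^ i)"
        by (rule power_diff_1_eq)
      ultimately have "p ^ k dvd b - 1"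
        using less.prems by (simp add: coprime_dvd_mult_left_iff)
      then have "k < c" using b(2) by (metis le_imp_power_dvd dvd_trans not_less)
      then show ?thesis by simp
    next
      case True
      define q where "q = nat p"
      have q: "int q = p" using p(1) prime_ge_0_int by (auto simp: q_def)
      from True obtain m' where m': "m = q * m'"
        using q by (metis int_dvd_int_iff dvdE)
      have q1: "q > 1" using q p1 by linarith
      have m'lt: "m' < m" using m' False q1 by simp
      define B where "B = b ^ m'"
      have "[B = 1] (mod p)" using cong_pow[OF b1, of m'] by (simp add: B_def)
      then obtain u where u: "B = 1 + p * u" by (metis cong_iff_lin cong_sym)
      \<comment> \<open>Modulo \<open>p^2\<close> the powers of \<open>B\<close> are linear in the
        exponent, so their sum is \<open>p\<close> plus \<open>p * u\<close> times
        \<open>0 + ... + (p - 1)\<close>, which \<open>p\<close> divides because \<open>p\<close> is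
        odd. The sum is thus exactly \<open>p\<close> times a unit.\<close>
      have Bi: "[B ^ i = 1 + int i * (p * u)] (mod p\<^sup>2)" for i
      proof (induction i)
        case (Suc i)
        have "[B * B ^ i = (1 + p * u) * (1 + int i * (p * u))] (mod p\<^sup>2)"
          using Suc by (auto intro!: cong_mult simp: u)
        moreover have "(1 + p * u) * (1 + int i * (p * u)) = 1 + int (Suc i) * (p * u) + p\<^sup>2 * (int i * u\<^sup>2)"
          by (simp add: algebra_simps power2_eq_square)
        ultimately show ?case by (simp add: cong_def)
      qed auto
      have "[(\<Sum>i<q. B ^ i) = (\<Sum>i<q. 1 + int i * (p * u))] (mod p\<^sup>2)"
        by (intro cong_sum Bi)
      moreover have "(\<Sum>i<q. 1 + int i * (p * u)) = p + p * u * (\<Sum>i<q. int i)"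
        by (simp add: sum.distrib sum_distrib_left sum_distrib_right q mult.commute mult.left_commute)
      moreover have psum: "p dvd (\<Sum>i<q. int i)"
      proof -
        have "2 * (\<Sum>i<q. int i) = p * (p - 1)"
        proof -
          have "2 * (\<Sum>i<n. int i) = int n * (int n - 1)" for n
            by (induction n) (auto simp: algebra_simps)
          then show ?thesis using q by metis
        qed
        then have "p dvd 2 * (\<Sum>i<q. int i)" by simp
        moreover have "coprime p 2" using p(2) by simp
        ultimately show ?thesis by (simp add: coprime_dvd_mult_right_iff)
      qed
      moreover have "p\<^sup>2 dvd p * u * (\<Sum>i<q. int i)"
        using mult_dvd_mono[OF dvd_triv_left[of p u] psum] by (simp add: power2_eq_square)
      then have "[p + p * u * (\<Sum>i<q. int i) = p] (mod p\<^sup>2)"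
        by (simp add: cong_iff_dvd_diff)
      ultimately have "[(\<Sum>i<q. B ^ i) = p] (mod p\<^sup>2)"
        by (metis cong_trans)
      then have "p\<^sup>2 dvd (\<Sum>i<q. B ^ i) - p" by (simp add: cong_iff_dvd_diff)
      then obtain s where "(\<Sum>i<q. B ^ i) - p = p\<^sup>2 * s" by (rule dvdE)
      then have s: "(\<Sum>i<q. B ^ i) = p * (1 + p * s)"
        by (simp add: algebra_simps power2_eq_square)
      have "b ^ m - 1 = (B - 1) * (\<Sum>i<q. B ^ i)"
        unfolding m' B_def by (subst power_diff_1_eq[symmetric]) (simp add: power_mult[symmetric] mult.commute)
      then have "p * p ^ (k - 1) dvd p * ((B - 1) * (1 + p * s))"
        using less.prems False unfolding s by (cases k) (auto simp: mult.left_commute)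
      then have "p ^ (k - 1) dvd (B - 1) * (1 + p * s)"
        using p1 by (subst (asm) dvd_mult_cancel_left) auto
      moreover have "\<not> p dvd 1 + p * s"
        using p1 by (metis dvd_add_left_iff dvd_triv_left zdvd1_eq less_irrefl)
      then have "coprime (p ^ (k - 1)) (1 + p * s)"
        using p(1) by (simp add: prime_imp_coprime)
      ultimately have "p ^ (k - 1) dvd b ^ m' - 1"
        by (simp add: coprime_dvd_mult_left_iff B_def)
      from less.IH[OF m'lt this] have "p ^ (k - 1 - c) dvd int m'" .
      then have "p * p ^ (k - 1 - c) dvd int m" unfolding m' using q by simp
      moreover have "p ^ (k - c) dvd p * p ^ (k - 1 - c)"
        unfolding power_Suc[symmetric] by (rule le_imp_power_dvd) simp
      ultimately show ?thesis by (rule dvd_trans[rotated])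
    qed
  qed
qed

lemma exists_power_cong_1:
  fixes a p :: int
  assumes "coprime a p" "p > 0"
  obtains s where "s > 0" "[a ^ s = 1] (mod p)"
proof -
  have "(\<lambda>i::nat. a ^ i mod p) ` UNIV \<subseteq> {0..<p}" using assms(2) by auto
  then have "finite ((\<lambda>i::nat. a ^ i mod p) ` UNIV)" using finite_subset by blast
  then have "\<not> inj (\<lambda>i::nat. a ^ i mod p)" using finite_imageD infinite_UNIV_nat by blast
  then obtain i j :: nat where ij: "i < j" "a ^ i mod p = a ^ j mod p"
    unfolding inj_def by (metis linorder_neqE_nat)
  then have "[a ^ i * a ^ (j - i) = a ^ i * 1] (mod p)"
    by (simp add: cong_def flip: power_add)
  then have "[a ^ (j - i) = 1] (mod p)"
    using assms(1) by (subst (asm) cong_mult_lcancel) auto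
  then show thesis using that[of "j - i"] ij by simp
qed

text \<open>Pigeonhole: the \<open>(M + 1)^d > q\<close> polynomials of degree below
  \<open>d\<close> with coefficients in \<open>{0..M}\<close> cannot all differ at \<open>a\<close>
  modulo \<open>q\<close>; \<open>h\<close> is a difference of two that agree.\<close>

lemma exists_small_poly_root_mod:
  fixes q M d :: nat and a :: int
  assumes "q > 0" "d > 0" "q \<le> M ^ d"
  obtains h :: "int poly" where "h \<noteq> 0" "degree h < d" "\<And>i. \<bar>coeff h i\<bar> \<le> int M" "int q dvd poly h a"
proof -
  define F where "F = (\<lambda>b :: nat \<Rightarrow> nat. \<Sum>l<d. monom (int (b l)) l)"
  define X where "X = (PiE {..<d} (\<lambda>_. {0..M}))"
  have coeff_F: "coeff (F b) i = (if i < d then int (b i) else 0)" for b i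
    by (simp add: F_def coeff_sum if_distrib[of "\<lambda>x. coeff x i"] sum.delta' cong: if_cong)
  have "(\<lambda>b. poly (F b) a mod int q) ` X \<subseteq> {0..<int q}"
    using assms(1) by auto
  then have "card ((\<lambda>b. poly (F b) a mod int q) ` X) \<le> q"
    using card_mono[of "{0..<int q}"] by fastforce
  also have "q < card X"
  proof -
    have "M ^ d < Suc M ^ d" using assms(2) by (simp add: power_strict_mono)
    then show ?thesis using assms(3) by (simp add: X_def card_PiE)
  qed
  finally have "\<not> inj_on (\<lambda>b. poly (F b) a mod int q) X"
    by (rule pigeonhole)
  then obtain b b' where b: "b \<in> X" "b' \<in> X" "b \<noteq> b'" "poly (F b) a mod int q = poly (F b') a mod int q"
    by (auto simp: inj_on_def)
  have cf: "coeff (F b - F b') i = (if i < d then int (b i) - int (b' i) else 0)" for i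
    by (simp add: coeff_F)
  show thesis
  proof (rule that)
    from b obtain l where l: "b l \<noteq> b' l" by auto
    with b have "l < d" unfolding X_def by (metis PiE_arb lessThan_iff)
    with l have "coeff (F b - F b') l \<noteq> 0" unfolding cf by simp
    then show "F b - F b' \<noteq> 0" by (metis coeff_0)
    have "degree (F b - F b') \<le> d - 1"
      by (rule degree_le) (use cf in auto)
    then show "degree (F b - F b') < d"
      using assms(2) by linarith
    show "\<bar>coeff (F b - F b') i\<bar> \<le> int M" for i
    proof (cases "i < d")
      case True
      then have "b i \<le> M" "b' i \<le> M" using b by (auto simp: X_def PiE_def Pi_def)
      then show ?thesis using True unfolding cf by auto
    qed (simp add: coeff_F)
    show "int q dvd poly (F b - F b') a"
      using b(4) by (simp add: mod_eq_dvd_iff)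
  qed
qed

section \<open>Integer polynomials acting on rational vectors\<close>

definition integral_vecs :: "(rat ^ 'n) set" where
  "integral_vecs = {z. \<forall>i. z $ i \<in> \<int>}"

definition rat_mat :: "int ^ 'n ^ 'n \<Rightarrow> rat ^ 'n ^ 'n" where
  "rat_mat A = (\<chi> i j. of_int (A $ i $ j))"

text \<open>The operator \<open>q(A)\<close>. Integer coefficients let an integral \<open>A\<close>
  preserve integral vectors and let values of \<open>q\<close> be reduced modulo prime
  powers.\<close>

definition poly_action :: "rat ^ 'n ^ 'n \<Rightarrow> int poly \<Rightarrow> rat ^ 'n \<Rightarrow> rat ^ 'n" where
  "poly_action A q x = (\<Sum>i\<le>degree q. of_int (coeff q i) *s ((*v) A ^^ i) x)"

lemma integral_vecs_0 [simp]: "0 \<in> integral_vecs"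
  by (simp add: integral_vecs_def)

lemma integral_vecs_add: "x \<in> integral_vecs \<Longrightarrow> y \<in> integral_vecs \<Longrightarrow> x + y \<in> integral_vecs"
  by (simp add: integral_vecs_def)

lemma integral_vecs_diff: "x \<in> integral_vecs \<Longrightarrow> y \<in> integral_vecs \<Longrightarrow> x - y \<in> integral_vecs"
  by (simp add: integral_vecs_def)

lemma integral_vecs_scale: "x \<in> integral_vecs \<Longrightarrow> of_int k *s x \<in> integral_vecs"
  by (simp add: integral_vecs_def)

lemma integral_vecs_sum: "(\<And>i. i \<in> I \<Longrightarrow> f i \<in> integral_vecs) \<Longrightarrow> sum f I \<in> integral_vecs"
  by (induction I rule: infinite_finite_induct) (auto intro: integral_vecs_add)

lemma integral_vecs_rat_mat: "x \<in> integral_vecs \<Longrightarrow> rat_mat A *v x \<in> integral_vecs"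
  by (auto simp: integral_vecs_def rat_mat_def matrix_vector_mult_def)

lemma integral_vecs_component_ge_1:
  assumes "x \<in> integral_vecs" "x $ i \<noteq> 0"
  shows "\<bar>x $ i\<bar> \<ge> 1"
  using assms Ints_nonzero_abs_ge1 unfolding integral_vecs_def by blast

lemma funpow_matrix_add:
  fixes A :: "'a::field ^ 'n ^ 'n"
  shows "((*v) A ^^ i) (x + y) = ((*v) A ^^ i) x + ((*v) A ^^ i) y"
  by (induction i) (auto simp: matrix_vector_right_distrib)

lemma funpow_matrix_scale:
  fixes A :: "'a::field ^ 'n ^ 'n"
  shows "((*v) A ^^ i) (c *s x) = c *s ((*v) A ^^ i) x"
  by (induction i) (auto simp: vec.scale)

lemma funpow_matrix_diff:
  fixes A :: "'a::field ^ 'n ^ 'n"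
  shows "((*v) A ^^ i) (x - y) = ((*v) A ^^ i) x - ((*v) A ^^ i) y"
  by (induction i) (auto simp: vec.diff)

lemma poly_action_bound:
  assumes "degree q \<le> N"
  shows "poly_action A q x = (\<Sum>i\<le>N. of_int (coeff q i) *s ((*v) A ^^ i) x)"
  unfolding poly_action_def using assms
  by (intro sum.mono_neutral_left) (auto simp: coeff_eq_0)

lemma poly_action_0 [simp]: "poly_action A 0 x = 0"
  by (simp add: poly_action_def)

lemma poly_action_pCons: "poly_action A (pCons a q) x = of_int a *s x + A *v poly_action A q x"
proof -
  have "poly_action A (pCons a q) x = (\<Sum>i\<le>Suc (degree q). of_int (coeff (pCons a q) i) *s ((*v) A ^^ i) x)"
    by (rule poly_action_bound) (rule degree_pCons_le)
  also have "\<dots> = of_int a *s x + (\<Sum>i\<le>degree q. of_int (coeff q i) *s (A *v ((*v) A ^^ i) x))"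
    by (simp add: sum.atMost_Suc_shift del: sum.atMost_Suc)
  also have "(\<Sum>i\<le>degree q. of_int (coeff q i) *s (A *v ((*v) A ^^ i) x)) = A *v poly_action A q x"
    by (simp add: poly_action_def vec.sum vec.scale)
  finally show ?thesis .
qed

lemma poly_action_add: "poly_action A (p + q) x = poly_action A p x + poly_action A q x"
proof -
  let ?N = "max (degree p) (degree q)"
  have "degree (p + q) \<le> ?N" by (rule degree_add_le_max)
  then show ?thesis
    by (simp add: poly_action_bound[of _ ?N] vec.scale_left_distrib sum.distrib)
qed

lemma poly_action_smult: "poly_action A (smult c q) x = of_int c *s poly_action A q x"
  by (simp add: poly_action_bound[OF degree_smult_le] poly_action_def vec.scale_sum_right)

lemma poly_action_diff: "poly_action A (p - q) x = poly_action A p x - poly_action A q x"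
  using poly_action_add[of A "p - q" q x] by simp

lemma poly_action_mult: "poly_action A (p * q) x = poly_action A p (poly_action A q x)"
  by (induction p) (simp_all add: poly_action_add poly_action_smult poly_action_pCons)

lemma poly_action_const [simp]: "poly_action A [:c:] x = of_int c *s x"
  by (simp add: poly_action_pCons)

lemma poly_action_1 [simp]: "poly_action A 1 x = x"
  by (simp add: one_pCons)

lemma poly_action_vec_0 [simp]: "poly_action A q 0 = 0"
  by (induction q) (auto simp: poly_action_pCons)

lemma poly_action_vec_add: "poly_action A q (x + y) = poly_action A q x + poly_action A q y"
  by (simp add: poly_action_def funpow_matrix_add vec.scale_right_distrib sum.distrib)

lemma poly_action_vec_scale: "poly_action A q (c *s x) = c *s poly_action A q x"
  by (simp add: poly_action_def funpow_matrix_scale vec.scale_sum_right mult.commute)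

lemma poly_action_vec_diff: "poly_action A q (x - y) = poly_action A q x - poly_action A q y"
  using poly_action_vec_add[of A q "x - y" y] by simp

lemma poly_action_monom: "poly_action A (monom c i) x = of_int c *s ((*v) A ^^ i) x"
  by (simp add: poly_action_bound[OF degree_monom_le] if_distrib[of "\<lambda>c. of_int c *s _"] cong: if_cong)

lemma poly_action_commute: "poly_action A p (poly_action A q x) = poly_action A q (poly_action A p x)"
  by (metis mult.commute poly_action_mult)

lemma poly_action_integral: "x \<in> integral_vecs \<Longrightarrow> poly_action (rat_mat A) q x \<in> integral_vecs"
  by (induction q) (auto simp: poly_action_pCons intro!: integral_vecs_add integral_vecs_scale integral_vecs_rat_mat)

lemma poly_action_subspace:
  assumes "vec.subspace W" "\<And>w. w \<in> W \<Longrightarrow> A *v w \<in> W" "x \<in> W"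
  shows "poly_action A q x \<in> W"
  using assms by (induction q) (auto simp: poly_action_pCons vec.subspace_0 intro!: vec.subspace_add vec.subspace_scale)

text \<open>On an eigenvector up to a negligible error, \<open>q\<close> acts as the scalar
  \<open>q(a)\<close> up to a negligible error.\<close>

lemma poly_action_linear_factor:
  "poly_action A q x = of_int (poly q a) *s x + poly_action A (synthetic_div q a) (poly_action A [:-a, 1:] x)"
proof -
  have "poly_action A q x = poly_action A (synthetic_div q a * [:-a, 1:] + [:poly q a:]) x"
    by (metis synthetic_div_correct' mult.commute)
  then show ?thesis by (simp only: poly_action_add poly_action_mult poly_action_const add.commute)
qed

section \<open>Denominators, size bounds and annihilating polynomials\<close>

lemma common_denominator:
  fixes S :: "rat set"
  assumes "finite S"
  obtains D :: int where "D > 0" "\<And>r. r \<in> S \<Longrightarrow> of_int D * r \<in> \<int>"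
  using assms
proof (induction S arbitrary: thesis)
  case empty
  then show ?case by (meson empty_iff zero_less_one)
next
  case (insert r S)
  obtain D where D: "D > 0" "\<And>r. r \<in> S \<Longrightarrow> of_int D * r \<in> \<int>" using insert.IH by blast
  obtain a b where ab: "b > 0" "r = of_int a / of_int b" by (cases r) (auto simp: Fract_of_int_quotient)
  show ?case
  proof (rule insert.prems)
    show "D * b > 0" using D ab by simp
    fix s assume "s \<in> insert r S"
    then consider "s = r" | "s \<in> S" by blast
    then show "of_int (D * b) * s \<in> \<int>"
    proof cases
      case 1
      then have "of_int (D * b) * s = of_int (D * a)" using ab by simp
      then show ?thesis by (simp only: Ints_of_int)
    next
      case 2
      have "of_int (D * b) * s = of_int b * (of_int D * s)" by simp
      then show ?thesis using D(2)[OF 2] by (metis Ints_mult Ints_of_int)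
    qed
  qed
qed

lemma vec_common_denominator:
  fixes x :: "rat ^ 'n"
  obtains D :: int where "D > 0" "of_int D *s x \<in> integral_vecs"
proof -
  obtain D :: int where "D > 0" "\<And>r. r \<in> range (($) x) \<Longrightarrow> of_int D * r \<in> \<int>"
    by (rule common_denominator[of "range (($) x)"]) auto
  then show thesis using that by (auto simp: integral_vecs_def)
qed

text \<open>A stand-in for the quotient by \<open>W\<close> with its lattice: \<open>g\<close> is a
  projection onto \<open>W\<close>, and \<open>P\<close> is \<open>1 - g\<close> with denominators
  cleared.\<close>

lemma integral_matrix_with_kernel:
  fixes W :: "(rat ^ 'n) set"
  assumes "vec.subspace W"
  obtains P :: "rat ^ 'n ^ 'n" where "\<And>x. P *v x = 0 \<longleftrightarrow> x \<in> W"
    "\<And>z. z \<in> integral_vecs \<Longrightarrow> P *v z \<in> integral_vecs"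
proof -
  have "Vector_Spaces.linear (*s) (*s) (\<lambda>x :: rat ^ 'n. x)" by (rule vec.linear_ident)
  from vec.linear_exists_left_inverse_on[OF this assms]
  obtain g :: "rat ^ 'n \<Rightarrow> rat ^ 'n" where g: "range g \<subseteq> W" "Vector_Spaces.linear (*s) (*s) g" "\<forall>v\<in>W. g v = v"
    by auto
  define G where "G = mat 1 - matrix g"
  have G: "G *v x = x - g x" for x
    by (simp add: G_def matrix_vector_mult_diff_rdistrib matrix_works[OF g(2)])
  obtain D :: int where D: "D > 0" "\<And>r. r \<in> range (\<lambda>(i, j). G $ i $ j) \<Longrightarrow> of_int D * r \<in> \<int>"
    by (rule common_denominator[of "range (\<lambda>(i, j). G $ i $ j)"]) auto
  define P where "P = (\<chi> i j. of_int D * G $ i $ j)"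
  have P: "P *v x = of_int D *s (G *v x)" for x
    by (simp add: P_def matrix_vector_mult_def vec_eq_iff sum_distrib_left mult.assoc)
  show thesis
  proof (rule that)
    show "P *v x = 0 \<longleftrightarrow> x \<in> W" for x
    proof -
      have "P *v x = 0 \<longleftrightarrow> x = g x" using D(1) by (simp add: P G)
      also have "\<dots> \<longleftrightarrow> x \<in> W" using g by (metis range_subsetD)
      finally show ?thesis .
    qed
    fix z :: "rat ^ 'n" assume z: "z \<in> integral_vecs"
    have "of_int D * G $ i $ j \<in> \<int>" for i j by (rule D(2)) auto
    then have "P $ i $ j \<in> \<int>" for i j by (simp add: P_def)
    then show "P *v z \<in> integral_vecs" using z
      by (auto simp: integral_vecs_def matrix_vector_mult_def intro!: Ints_sum Ints_mult)
  qed
qed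

lemma matrix_sup_bound:
  fixes P :: "rat ^ 'n ^ 'n"
  obtains K :: rat where "K > 0"
    "\<And>x \<epsilon> i. (\<And>j. \<bar>x $ j\<bar> \<le> \<epsilon>) \<Longrightarrow> \<bar>(P *v x) $ i\<bar> \<le> K * \<epsilon>"
proof -
  define K where "K = 1 + (\<Sum>i\<in>UNIV. \<Sum>j\<in>UNIV. \<bar>P $ i $ j\<bar>)"
  show thesis
  proof (rule that)
    show "K > 0" unfolding K_def by (simp add: add_pos_nonneg sum_nonneg)
    fix x :: "rat ^ 'n" and \<epsilon> i assume x: "\<And>j. \<bar>x $ j\<bar> \<le> \<epsilon>"
    have \<epsilon>: "\<epsilon> \<ge> 0" using x[of undefined] by linarith
    have "\<bar>(P *v x) $ i\<bar> \<le> (\<Sum>j\<in>UNIV. \<bar>P $ i $ j\<bar> * \<bar>x $ j\<bar>)"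
      unfolding matrix_vector_mult_def by (simp add: sum_abs[THEN order_trans] abs_mult)
    also have "\<dots> \<le> (\<Sum>j\<in>UNIV. \<bar>P $ i $ j\<bar>) * \<epsilon>"
      unfolding sum_distrib_right by (intro sum_mono mult_left_mono x) auto
    also have "\<dots> \<le> K * \<epsilon>"
      unfolding K_def using \<epsilon> member_le_sum[of i UNIV "\<lambda>i. \<Sum>j\<in>UNIV. \<bar>P $ i $ j\<bar>"]
      by (intro mult_right_mono) (auto simp: sum_nonneg)
    finally show "\<bar>(P *v x) $ i\<bar> \<le> K * \<epsilon>" .
  qed
qed

lemma poly_action_sup_bound:
  fixes A :: "rat ^ 'n ^ 'n"
  obtains K :: rat where "K > 0"
    "\<And>h x \<epsilon> M i. degree h < d \<Longrightarrow> (\<And>j. \<bar>coeff h j\<bar> \<le> int M) \<Longrightarrow> (\<And>j. \<bar>x $ j\<bar> \<le> \<epsilon>) \<Longrightarrow>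
       \<bar>poly_action A h x $ i\<bar> \<le> K * of_nat M * \<epsilon>"
proof -
  obtain K where K: "K > 0" "\<And>x \<epsilon> i. (\<And>j. \<bar>x $ j\<bar> \<le> \<epsilon>) \<Longrightarrow> \<bar>(A *v x) $ i\<bar> \<le> K * \<epsilon>"
    by (rule matrix_sup_bound[of A]) blast
  have pow: "\<bar>((*v) A ^^ l) x $ i\<bar> \<le> K ^ l * \<epsilon>" if "\<And>j. \<bar>x $ j\<bar> \<le> \<epsilon>" for x \<epsilon> i l
    using that by (induction l arbitrary: i) (auto simp: mult.assoc intro!: K(2))
  show thesis
  proof (rule that)
    show "1 + (\<Sum>l\<le>d. K ^ l) > 0" using K(1) by (simp add: add_pos_nonneg sum_nonneg)
    fix h :: "int poly" and x :: "rat ^ 'n" and \<epsilon> M i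
    assume h: "degree h < d" "\<And>j. \<bar>coeff h j\<bar> \<le> int M" and x: "\<And>j. \<bar>x $ j\<bar> \<le> \<epsilon>"
    have \<epsilon>: "\<epsilon> \<ge> 0" using x[of undefined] by linarith
    have cf: "\<bar>of_int (coeff h j) :: rat\<bar> \<le> of_nat M" for j
      using h(2)[of j] by (metis of_int_abs of_int_le_iff of_int_of_nat_eq)
    have "\<bar>poly_action A h x $ i\<bar> = \<bar>\<Sum>l\<le>d. of_int (coeff h l) * ((*v) A ^^ l) x $ i\<bar>"
      using h(1) by (simp add: poly_action_bound[of h d])
    also have "\<dots> \<le> (\<Sum>l\<le>d. \<bar>of_int (coeff h l)\<bar> * \<bar>((*v) A ^^ l) x $ i\<bar>)"
      by (simp add: sum_abs[THEN order_trans] abs_mult)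
    also have "\<dots> \<le> (\<Sum>l\<le>d. of_nat M * (K ^ l * \<epsilon>))"
      by (intro sum_mono mult_mono cf pow x) auto
    also have "\<dots> = (\<Sum>l\<le>d. K ^ l) * of_nat M * \<epsilon>"
      by (simp add: sum_distrib_left sum_distrib_right mult_ac)
    also have "\<dots> \<le> (1 + (\<Sum>l\<le>d. K ^ l)) * of_nat M * \<epsilon>"
      using \<epsilon> by (intro mult_right_mono) auto
    finally show "\<bar>poly_action A h x $ i\<bar> \<le> (1 + (\<Sum>l\<le>d. K ^ l)) * of_nat M * \<epsilon>" .
  qed
qed

lemma exists_annihilating_poly:
  fixes A :: "rat ^ 'n ^ 'n"
  obtains F :: "int poly" where "F \<noteq> 0" "poly_action A F x = 0"
proof -
  let ?u = "\<lambda>i. ((*v) A ^^ i) x"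
  let ?n = "CARD('n)"
  show thesis
  \<comment> \<open>If two iterates coincide, the set of iterates may be too small to be dependent,
    but the difference of two monomials annihilates \<open>x\<close>.\<close>
  proof (cases "inj_on ?u {..?n}")
    case False
    then obtain i j where ij: "i \<noteq> j" "?u i = ?u j" by (auto simp: inj_on_def)
    show ?thesis
    proof (rule that)
      have "coeff (monom 1 i - monom 1 j :: int poly) i = 1" using ij by simp
      then show "monom 1 i - monom 1 j \<noteq> (0 :: int poly)" by (metis coeff_0 zero_neq_one)
      show "poly_action A (monom 1 i - monom 1 j) x = 0"
        using ij by (simp add: poly_action_diff poly_action_monom)
    qed
  next
    case True
    let ?S = "?u ` {..?n}"
    have "card ?S = Suc ?n" using True by (simp add: card_image)
    then have "vec.dependent ?S"
      using vec.independent_card_le_dim[of ?S UNIV] by (auto simp: vec.dim_UNIV card_cart_basis)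
    then obtain c where c: "\<exists>v\<in>?S. c v \<noteq> 0" "(\<Sum>v\<in>?S. c v *s v) = 0"
      by (subst (asm) vec.dependent_finite) auto
    obtain D :: int where D: "D > 0" "\<And>r. r \<in> c ` ?S \<Longrightarrow> of_int D * r \<in> \<int>"
      by (rule common_denominator[of "c ` ?S"]) auto
    define F where "F = (\<Sum>i\<le>?n. monom \<lfloor>of_int D * c (?u i)\<rfloor> i)"
    have cF: "coeff F i = (if i \<le> ?n then \<lfloor>of_int D * c (?u i)\<rfloor> else 0)" for i
      by (simp add: F_def coeff_sum if_distrib[of "\<lambda>x. coeff x i"] cong: if_cong)
    have cF': "of_int (coeff F i) = of_int D * c (?u i)" if "i \<le> ?n" for i
      using that D(2) by (auto simp: cF)
    show ?thesis
    proof (rule that)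
      from c obtain i where "i \<le> ?n" "c (?u i) \<noteq> 0" by auto
      then have "of_int (coeff F i) \<noteq> (0 :: rat)" using cF' D(1) by simp
      then show "F \<noteq> 0" by (metis coeff_0 of_int_0)
      have "degree F \<le> ?n" by (rule degree_le) (use cF in auto)
      then have "poly_action A F x = (\<Sum>i\<le>?n. of_int (coeff F i) *s ?u i)"
        by (rule poly_action_bound)
      also have "\<dots> = (\<Sum>i\<le>?n. of_int D *s (c (?u i) *s ?u i))"
        by (intro sum.cong) (auto simp: cF')
      also have "\<dots> = of_int D *s (\<Sum>i\<le>?n. c (?u i) *s ?u i)"
        by (simp add: vec.scale_sum_right)
      also have "(\<Sum>i\<le>?n. c (?u i) *s ?u i) = (\<Sum>v\<in>?S. c v *s v)"
        by (simp add: sum.reindex[OF True])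
      finally show "poly_action A F x = 0" using c by simp
    qed
  qed
qed

lemma det_rat_mat: "det (rat_mat A) = of_int (det A)"
  by (simp add: det_def rat_mat_def)

section \<open>Minimal invariant extensions\<close>

locale aperiodic_matrix =
  fixes A :: "int ^ 'n ^ 'n"
  assumes aperiodic: "s > 0 \<Longrightarrow> ((*v) (rat_mat A) ^^ s) x = x \<Longrightarrow> x = 0"
    and det_nonzero: "det A \<noteq> 0"
begin

abbreviation T :: "rat ^ 'n \<Rightarrow> rat ^ 'n" where
  "T \<equiv> (*v) (rat_mat A)"

abbreviation act :: "int poly \<Rightarrow> rat ^ 'n \<Rightarrow> rat ^ 'n" where
  "act \<equiv> poly_action (rat_mat A)"

lemma nonsingular:
  assumes "T x = 0"
  shows "x = 0"
proof -
  have "invertible (rat_mat A)" using det_nonzero by (simp add: invertible_det_nz det_rat_mat)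
  then have "inj T" by (simp add: invertible_eq_bij bij_is_inj)
  then show ?thesis using assms by (metis injD matrix_vector_mult_0_right)
qed

lemma linear_act: "Vector_Spaces.linear (*s) (*s) (act q)"
  by unfold_locales (simp_all add: poly_action_vec_add poly_action_vec_scale)

text \<open>An injective operator that preserves the finite-dimensional \<open>W\<close> maps it
  onto itself, so it sends nothing outside \<open>W\<close> into \<open>W\<close>.\<close>

lemma mem_subspace_if_act_mem:
  assumes W: "vec.subspace W" "\<And>w. w \<in> W \<Longrightarrow> T w \<in> W"
    and inj: "\<And>x. act q x = 0 \<Longrightarrow> x = 0" and y: "act q y \<in> W"
  shows "y \<in> W"
proof -
  have inj': "inj (act q)"
    by (rule injI) (metis inj poly_action_vec_diff right_minus_eq)
  have "act q ` W = W"
  proof (rule vec.subspace_dim_equal)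
    show "vec.subspace (act q ` W)" by (rule vec.linear_subspace_image[OF linear_act W(1)])
    show "act q ` W \<subseteq> W" using poly_action_subspace[OF W] by blast
    show "vec.dim W \<le> vec.dim (act q ` W)"
      using vec.dim_image_eq[OF linear_act inj_on_subset[OF inj' subset_UNIV]] by (simp add: order_refl)
  qed (rule W)
  then obtain w where "w \<in> W" "act q y = act q w" using y by (metis imageE)
  then show ?thesis using inj' by (metis injD)
qed

end

text \<open>
  The minimality assumption ranges over all vectors outside \<open>W\<close>, not only over \<open>e\<close>; it replaces
  irreducibility of the quotient of the extended subspace by \<open>W\<close>.
\<close>

locale minimal_extension = aperiodic_matrix A for A :: "int ^ 'n ^ 'n" +
  fixes W :: "(rat ^ 'n) set" and e :: "rat ^ 'n" and f :: "int poly"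
  assumes subspace: "vec.subspace W" and invariant: "\<And>w. w \<in> W \<Longrightarrow> T w \<in> W"
    and e: "e \<notin> W" "e \<in> integral_vecs"
    and f: "f \<noteq> 0" "act f e \<in> W"
    and minimal: "\<And>w h. w \<notin> W \<Longrightarrow> h \<noteq> 0 \<Longrightarrow> degree h < degree f \<Longrightarrow> act h w \<notin> W"
begin

lemma act_W: "w \<in> W \<Longrightarrow> act q w \<in> W"
  by (rule poly_action_subspace[OF subspace invariant])

lemma W_scale_iff: "c \<noteq> 0 \<Longrightarrow> c *s x \<in> W \<longleftrightarrow> x \<in> W"
  using vec.subspace_scale[OF subspace, of "c *s x" "inverse c"] vec.subspace_scale[OF subspace, of x c]
  by auto

lemma degree_f_pos: "degree f > 0"
proof (rule ccontr)
  assume "\<not> degree f > 0"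
  then obtain c where "f = [:c:]" by (metis degree_0_id neq0_conv degree_eq_zeroE)
  then show False using f e W_scale_iff[of "of_int c" e] by auto
qed

text \<open>Pseudo-division by \<open>f\<close> leaves a remainder of smaller degree that maps
  \<open>e\<close> into \<open>W\<close>; by minimality it is zero. The factor \<open>a\<close> pays
  for dividing over the integers.\<close>

lemma f_dvd_if_act_mem:
  assumes "act q e \<in> W"
  obtains a s where "a \<noteq> 0" "smult a q = f * s"
proof -
  obtain a s where as: "a \<noteq> 0" "smult a q = f * s + pseudo_mod q f"
    using pseudo_mod(1)[OF f(1)] by blast
  have "act (pseudo_mod q f) e = of_int a *s act q e - act s (act f e)"
    using arg_cong[OF as(2), of "\<lambda>r. act r e"]
    by (simp add: poly_action_add poly_action_mult poly_action_smult poly_action_commute[of _ f])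
  also have "\<dots> \<in> W" by (intro vec.subspace_diff[OF subspace] vec.subspace_scale[OF subspace] assms act_W f)
  finally have "pseudo_mod q f = 0"
    using minimal[OF e(1)] pseudo_mod(2)[OF f(1)] by blast
  then show thesis using that as by simp
qed

text \<open>Otherwise \<open>f = x * h\<close>, and invertibility of \<open>A\<close> would put
  \<open>h(A) e\<close> into \<open>W\<close>, against minimality.\<close>

lemma poly_f_0: "poly f 0 \<noteq> 0"
proof
  assume "poly f 0 = 0"
  then obtain h where h: "f = pCons 0 h" by (cases f) auto
  then have "h \<noteq> 0" "degree h < degree f" using f by auto
  then have "act h e \<notin> W" using minimal[OF e(1)] by blast
  moreover have "act [:0, 1:] (act h e) \<in> W" using f(2) unfolding h by (simp add: poly_action_pCons)
  ultimately show False
    using mem_subspace_if_act_mem[OF subspace invariant, of "[:0, 1:]"] nonsingular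
    by (auto simp: poly_action_pCons)
qed

text \<open>A nonzero \<open>g\<close> of least degree in the ideal of \<open>f\<close> and
  \<open>q\<close> divides both up to integer factors, and minimality makes it constant. At roots of
  \<open>f\<close> modulo a prime not dividing \<open>R\<close>, the value of \<open>q\<close> is
  then a unit.\<close>

lemma bezout:
  assumes q: "act q e \<notin> W"
  obtains U V :: "int poly" and R :: int where "R \<noteq> 0" "U * f + V * q = [:R:]"
proof -
  define I where "I = {g. g \<noteq> 0 \<and> (\<exists>U V. g = U * f + V * q)}"
  have "f = 1 * f + 0 * q" by simp
  then have "f \<in> I" using f(1) unfolding I_def by blast
  then obtain g where g: "g \<in> I" "\<And>h. h \<in> I \<Longrightarrow> degree g \<le> degree h"
    using ex_has_least_nat[of "\<lambda>g. g \<in> I" f degree] by blast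
  from g(1) obtain U V where g0: "g \<noteq> 0" and UV: "g = U * f + V * q" by (auto simp: I_def)
  have dvd: "\<exists>a s. a \<noteq> 0 \<and> smult a r = g * s" if r: "r = U' * f + V' * q" for r U' V'
  proof -
    obtain a s where as: "a \<noteq> 0" "smult a r = g * s + pseudo_mod r g"
      using pseudo_mod(1)[OF g0] by blast
    have "pseudo_mod r g = smult a r - g * s" using as by simp
    also have "\<dots> = (smult a U' - U * s) * f + (smult a V' - V * s) * q"
      unfolding r UV by (simp add: algebra_simps smult_add_right)
    finally have "pseudo_mod r g = 0"
      using g(2)[of "pseudo_mod r g"] pseudo_mod(2)[OF g0, of r] unfolding I_def by force
    then show ?thesis using as by auto
  qed
  obtain a s where as: "a \<noteq> 0" "smult a f = g * s" using dvd[of f 1 0] by auto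
  obtain b r where br: "b \<noteq> 0" "smult b q = g * r" using dvd[of q 0 1] by auto
  have s0: "s \<noteq> 0" using as f(1) by auto
  have deg: "degree f = degree g + degree s"
    using as g0 s0 by (metis degree_mult_eq degree_smult_eq)
  have "degree g = 0"
  proof (rule ccontr)
    assume "degree g \<noteq> 0"
    then have "degree s < degree f" using deg by simp
    \<comment> \<open>Minimality is used twice: for \<open>e\<close> it puts \<open>s(A) e\<close>
      outside \<open>W\<close>; for the vector \<open>s(A) e\<close> it then gives
      \<open>degree g \<ge> degree f\<close>. So \<open>s\<close> is constant, \<open>g\<close> maps
      \<open>e\<close> into \<open>W\<close>, and hence so does \<open>q\<close>.\<close>
    then have s: "act s e \<notin> W" using minimal[OF e(1) s0] by blast
    have "act g (act s e) = of_int a *s act f e"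
      using arg_cong[OF as(2), of "\<lambda>r. act r e"] by (simp add: poly_action_mult poly_action_smult)
    then have "act g (act s e) \<in> W" using f(2) vec.subspace_scale[OF subspace] by simp
    then have "\<not> degree g < degree f" using minimal[OF s g0] by blast
    then have "degree s = 0" using deg by simp
    then obtain c where c: "s = [:c:]" by (metis degree_eq_zeroE)
    have "of_int c *s act g e \<in> W"
      using \<open>act g (act s e) \<in> W\<close> by (simp add: c poly_action_vec_scale)
    then have "act g e \<in> W" using s0 c W_scale_iff by auto
    then have "act r (act g e) \<in> W" by (rule act_W)
    moreover have "act r (act g e) = of_int b *s act q e"
      using arg_cong[OF br(2), of "\<lambda>r. act r e"]
      by (simp add: poly_action_mult poly_action_smult poly_action_commute[of _ g])
    ultimately show False using q br(1) W_scale_iff by auto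
  qed
  then obtain R where "g = [:R:]" by (metis degree_eq_zeroE)
  then show thesis using that[of R U V] g0 UV by auto
qed

text \<open>Strip as many factors \<open>f\<close> as possible from an annihilator of
  \<open>e\<close>: if a \<open>g\<close> of least degree still mapped \<open>e\<close> into
  \<open>W\<close>, another factor \<open>f\<close> would split off.\<close>

lemma annihilating_factorization:
  obtains E g where "E \<ge> 1" "act (f ^ E * g) e = 0" "act g e \<notin> W"
proof -
  define G where "G = {g. g \<noteq> 0 \<and> (\<exists>E. act (f ^ E * g) e = 0)}"
  obtain F where "F \<noteq> 0" "act F e = 0" by (rule exists_annihilating_poly)
  then have "F \<in> G" unfolding G_def by (auto intro!: exI[of _ 0])
  then obtain g where g: "g \<in> G" "\<And>h. h \<in> G \<Longrightarrow> degree g \<le> degree h"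
    using ex_has_least_nat[of "\<lambda>g. g \<in> G" F degree] by blast
  then obtain E where E: "g \<noteq> 0" "act (f ^ E * g) e = 0" by (auto simp: G_def)
  have "act g e \<notin> W"
  proof
    assume "act g e \<in> W"
    then obtain a s where as: "a \<noteq> 0" "smult a g = f * s" by (rule f_dvd_if_act_mem)
    have s0: "s \<noteq> 0" using as E(1) by auto
    have "f ^ Suc E * s = f ^ E * (f * s)" by (simp add: mult_ac)
    also have "\<dots> = smult a (f ^ E * g)" by (simp flip: as(2))
    finally have "f ^ Suc E * s = smult a (f ^ E * g)" .
    then have "act (f ^ Suc E * s) e = 0" using E(2) by (simp add: poly_action_smult)
    then have "s \<in> G" using s0 unfolding G_def by blast
    moreover have "degree g = degree f + degree s"
      using as s0 f(1) by (metis degree_mult_eq degree_smult_eq)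
    ultimately show False using g(2) degree_f_pos by force
  qed
  moreover have "act (f ^ Suc E * g) e = 0"
    using E(2) by (simp add: poly_action_mult)
  ultimately show thesis using that[of "Suc E" g] by simp
qed

text \<open>The span of \<open>W\<close> and \<open>T^i e\<close> for \<open>i < k\<close>, with
  denominators collected in \<open>D\<close>. Vanishing coefficients in place of a degree bound make
  \<open>ext 0\<close> equal to \<open>W\<close>. \<open>ext (degree f)\<close> is the next subspace
  of the flag, and \<open>ext (degree f - 1)\<close> a hyperplane in it.\<close>

definition ext :: "nat \<Rightarrow> (rat ^ 'n) set" where
  "ext k = {x. \<exists>D h. D \<noteq> 0 \<and> (\<forall>i\<ge>k. coeff h i = 0) \<and> of_int D *s x - act h e \<in> W}"

lemma subspace_ext: "vec.subspace (ext k)"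
proof (rule vec.subspaceI)
  show "0 \<in> ext k" unfolding ext_def using vec.subspace_0[OF subspace]
    by (intro CollectI exI[of _ 1] exI[of _ 0]) simp
next
  fix x y assume "x \<in> ext k" "y \<in> ext k"
  then obtain D h D' h' where x: "D \<noteq> 0" "\<forall>i\<ge>k. coeff h i = 0" "of_int D *s x - act h e \<in> W"
    and y: "D' \<noteq> 0" "\<forall>i\<ge>k. coeff h' i = 0" "of_int D' *s y - act h' e \<in> W"
    unfolding ext_def by blast
  have "of_int (D * D') *s (x + y) - act (smult D' h + smult D h') e =
      of_int D' *s (of_int D *s x - act h e) + of_int D *s (of_int D' *s y - act h' e)"
    by (simp add: poly_action_add poly_action_smult vec_eq_iff algebra_simps)
  also have "\<dots> \<in> W" by (intro vec.subspace_add[OF subspace] vec.subspace_scale[OF subspace] x y)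
  finally show "x + y \<in> ext k"
    using x y unfolding ext_def by (intro CollectI exI[of _ "D * D'"] exI[of _ "smult D' h + smult D h'"]) auto
next
  fix c :: rat and x assume "x \<in> ext k"
  then obtain D h where x: "D \<noteq> 0" "\<forall>i\<ge>k. coeff h i = 0" "of_int D *s x - act h e \<in> W"
    unfolding ext_def by blast
  obtain a b where ab: "b > 0" "c = of_int a / of_int b" by (cases c) (auto simp: Fract_of_int_quotient)
  have "of_int (D * b) *s (c *s x) - act (smult a h) e = of_int a *s (of_int D *s x - act h e)"
    using ab by (simp add: poly_action_smult vec_eq_iff algebra_simps)
  also have "\<dots> \<in> W" by (intro vec.subspace_scale[OF subspace] x)
  finally show "c *s x \<in> ext k"
    using x ab unfolding ext_def by (intro CollectI exI[of _ "D * b"] exI[of _ "smult a h"]) auto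
qed

lemma W_subset_ext: "W \<subseteq> ext k"
proof
  fix x assume "x \<in> W"
  then show "x \<in> ext k" unfolding ext_def by (intro CollectI exI[of _ 1] exI[of _ 0]) simp
qed

lemma act_e_mem_ext: "act q e \<in> ext (degree f)"
proof -
  obtain a s where as: "a \<noteq> 0" "smult a q = f * s + pseudo_mod q f"
    using pseudo_mod(1)[OF f(1)] by blast
  have "of_int a *s act q e - act (pseudo_mod q f) e = act s (act f e)"
    using arg_cong[OF as(2), of "\<lambda>r. act r e"]
    by (simp add: poly_action_add poly_action_mult poly_action_smult poly_action_commute[of _ f])
  also have "\<dots> \<in> W" by (rule act_W[OF f(2)])
  finally show ?thesis
    using pseudo_mod(2)[OF f(1), of q] as(1) unfolding ext_def
    by (intro CollectI exI[of _ a] exI[of _ "pseudo_mod q f"]) (auto intro: coeff_eq_0)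
qed

lemma invariant_ext:
  assumes "x \<in> ext (degree f)"
  shows "T x \<in> ext (degree f)"
proof -
  obtain D h where x: "D \<noteq> 0" "of_int D *s x - act h e \<in> W"
    using assms unfolding ext_def by blast
  have "T (of_int D *s x - act h e) \<in> ext (degree f)" using invariant[OF x(2)] W_subset_ext by blast
  then have "T (of_int D *s x - act h e) + act (pCons 0 h) e \<in> ext (degree f)"
    by (intro vec.subspace_add[OF subspace_ext] act_e_mem_ext)
  then have "of_int D *s T x \<in> ext (degree f)"
    by (simp add: poly_action_pCons vec.diff vec.scale)
  then have "inverse (of_int D) *s (of_int D *s T x) \<in> ext (degree f)"
    by (rule vec.subspace_scale[OF subspace_ext])
  then show ?thesis using x(1) by simp
qed

lemma dim_ext_le: "vec.dim (ext (degree f)) \<le> vec.dim W + degree f"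
proof -
  obtain B where B: "B \<subseteq> W" "vec.independent B" "W \<subseteq> vec.span B" "card B = vec.dim W"
    using vec.basis_exists by blast
  let ?S = "(\<lambda>i. (T ^^ i) e) ` {..<degree f}"
  have "ext (degree f) \<subseteq> vec.span (B \<union> ?S)"
  proof
    fix x assume "x \<in> ext (degree f)"
    then obtain D h where x: "D \<noteq> 0" "\<forall>i\<ge>degree f. coeff h i = 0" "of_int D *s x - act h e \<in> W"
      unfolding ext_def by blast
    have "act h e \<in> vec.span (B \<union> ?S)"
      unfolding poly_action_def
    proof (rule vec.span_sum)
      fix i assume "i \<in> {..degree h}"
      show "of_int (coeff h i) *s (T ^^ i) e \<in> vec.span (B \<union> ?S)"
      proof (cases "i < degree f")
        case True
        then show ?thesis by (intro vec.span_scale vec.span_base) auto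
      qed (use x vec.span_zero in simp)
    qed
    moreover have "of_int D *s x - act h e \<in> vec.span (B \<union> ?S)"
      using x(3) B(3) vec.span_mono[of B "B \<union> ?S"] by blast
    ultimately have "of_int D *s x - act h e + act h e \<in> vec.span (B \<union> ?S)"
      by (intro vec.span_add)
    then have "inverse (of_int D) *s (of_int D *s x) \<in> vec.span (B \<union> ?S)"
      by (simp only: diff_add_cancel vec.span_scale)
    then show "x \<in> vec.span (B \<union> ?S)" using x(1) by simp
  qed
  moreover have "finite (B \<union> ?S)" using B(2) vec.finiteI_independent by blast
  ultimately have "vec.dim (ext (degree f)) \<le> card (B \<union> ?S)"
    by (rule vec.dim_le_card)
  also have "\<dots> \<le> card B + card ?S" by (rule card_Un_le)
  also have "card ?S \<le> degree f" by (metis card_image_le card_lessThan finite_lessThan)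
  finally show ?thesis using B(4) by simp
qed

text \<open>A coordinate of \<open>P\<close> is a functional, integral on the lattice, that vanishes
  on \<open>ext (degree f - 1)\<close> and takes the value \<open>\<Delta>\<close> at
  \<open>T^(degree f - 1) e\<close>. It reads off the top coefficient of \<open>q\<close>.\<close>

lemma top_coeff_detector:
  obtains \<Delta> :: int where "\<Delta> \<noteq> 0"
    "\<And>q n z. degree q < degree f \<Longrightarrow> z \<in> integral_vecs \<Longrightarrow> act q e - of_int n *s z \<in> W \<Longrightarrow>
       n dvd coeff q (degree f - 1) * \<Delta>"
proof -
  let ?k = "degree f - 1"
  let ?y = "(T ^^ ?k) e"
  obtain P :: "rat ^ 'n ^ 'n" where P: "\<And>x. P *v x = 0 \<longleftrightarrow> x \<in> ext ?k"
    "\<And>z. z \<in> integral_vecs \<Longrightarrow> P *v z \<in> integral_vecs"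
    by (rule integral_matrix_with_kernel[OF subspace_ext[of ?k]]) blast
  have "?y \<notin> ext ?k"
  proof
    assume "?y \<in> ext ?k"
    then obtain D h where h: "D \<noteq> 0" "\<forall>i\<ge>?k. coeff h i = 0" "of_int D *s ?y - act h e \<in> W"
      unfolding ext_def by blast
    let ?q = "monom D ?k - h"
    have "act ?q e \<in> W" using h(3) by (simp add: poly_action_diff poly_action_monom)
    moreover have "coeff ?q ?k \<noteq> 0" using h by simp
    then have "?q \<noteq> 0" by (metis coeff_0)
    moreover have "degree ?q \<le> ?k" by (rule degree_le) (use h(2) in auto)
    then have "degree ?q < degree f" using degree_f_pos by linarith
    ultimately show False using minimal[OF e(1)] by blast
  qed
  then have "P *v ?y \<noteq> 0" using P(1) by blast
  then obtain i where i: "(P *v ?y) $ i \<noteq> 0" by (auto simp: vec_eq_iff)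
  have "?y = act (monom 1 ?k) e" by (simp add: poly_action_monom)
  then have "P *v ?y \<in> integral_vecs" using P(2) poly_action_integral[OF e(2)] by metis
  then obtain \<Delta> where \<Delta>: "(P *v ?y) $ i = of_int \<Delta>"
    by (auto simp: integral_vecs_def elim: Ints_cases)
  show thesis
  proof (rule that)
    show "\<Delta> \<noteq> 0" using i \<Delta> by auto
    fix q n and z :: "rat ^ 'n"
    assume q: "degree q < degree f" and z: "z \<in> integral_vecs" and W: "act q e - of_int n *s z \<in> W"
    let ?r = "q - monom (coeff q ?k) ?k"
    have r: "coeff ?r j = 0" if "j \<ge> ?k" for j
    proof (cases "j = ?k")
      case False
      then have "degree q < j" using that q by linarith
      then show ?thesis using False by (simp add: coeff_eq_0)
    qed simp
    have "of_int 1 *s act ?r e - act ?r e \<in> W" using vec.subspace_0[OF subspace] by simp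
    then have "act ?r e \<in> ext ?k"
      unfolding ext_def using r zero_neq_one[symmetric, where 'a=int] by blast
    then have "P *v act ?r e = 0" using P(1) by blast
    then have "P *v act q e = of_int (coeff q ?k) *s (P *v ?y)"
      by (simp add: poly_action_diff poly_action_monom vec.diff vec.scale)
    moreover have "P *v (act q e - of_int n *s z) = 0" using P(1) W W_subset_ext by blast
    ultimately have eq: "of_int (coeff q ?k) *s (P *v ?y) = of_int n *s (P *v z)"
      by (simp add: vec.diff vec.scale)
    obtain b where b: "(P *v z) $ i = of_int b"
      using P(2)[OF z] by (auto simp: integral_vecs_def elim: Ints_cases)
    have "of_int (coeff q ?k * \<Delta>) = (of_int (n * b) :: rat)"
      using arg_cong[OF eq, of "\<lambda>x. x $ i"] \<Delta> by (simp add: b)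
    then show "n dvd coeff q ?k * \<Delta>" by (metis dvd_triv_left of_int_eq_iff)
  qed
qed

end

section \<open>The lattice modulo \<open>W\<close> and torsion eigenvectors\<close>

context minimal_extension
begin

text \<open>The preimage of the image of the integral lattice in the quotient by
  \<open>W\<close>.\<close>

definition lat :: "(rat ^ 'n) set" where
  "lat = {x. \<exists>z\<in>integral_vecs. x - z \<in> W}"

lemma lat_integral: "x \<in> integral_vecs \<Longrightarrow> x \<in> lat"
  unfolding lat_def using vec.subspace_0[OF subspace] by (auto intro!: bexI[of _ x])

lemma lat_W: "x \<in> W \<Longrightarrow> x \<in> lat"
  unfolding lat_def by (auto intro!: bexI[of _ 0])

lemma lat_add:
  assumes "x \<in> lat" "y \<in> lat"
  shows "x + y \<in> lat"
proof -
  from assms obtain z z' where "z \<in> integral_vecs" "x - z \<in> W" "z' \<in> integral_vecs" "y - z' \<in> W"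
    unfolding lat_def by blast
  then have "z + z' \<in> integral_vecs" "(x - z) + (y - z') \<in> W"
    by (auto intro: integral_vecs_add vec.subspace_add[OF subspace])
  then show ?thesis unfolding lat_def by (auto intro!: bexI[of _ "z + z'"] simp: algebra_simps)
qed

lemma lat_act:
  assumes "x \<in> lat"
  shows "act q x \<in> lat"
proof -
  from assms obtain z where "z \<in> integral_vecs" "x - z \<in> W" unfolding lat_def by blast
  then have "act q z \<in> integral_vecs" "act q (x - z) \<in> W" by (auto intro: poly_action_integral act_W)
  then show ?thesis unfolding lat_def by (auto simp: poly_action_vec_diff)
qed

lemma lat_scale: "x \<in> lat \<Longrightarrow> of_int c *s x \<in> lat"
  using lat_act[of x "[:c:]"] by simp

lemma lat_diff: "x \<in> lat \<Longrightarrow> y \<in> lat \<Longrightarrow> x - y \<in> lat"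
  using lat_add[of x "of_int (-1) *s y"] lat_scale[of y "-1"] by simp

text \<open>
  The vector is \<open>p ^ -k\<close> times \<open>fa ^ E * g\<close> applied to \<open>e\<close>, where \<open>f = (x - a) * fa + f(a)\<close>: multiplying
  by \<open>(x - a) ^ E\<close> gives \<open>f ^ E * g\<close> modulo \<open>p ^ k\<close>, which annihilates \<open>e\<close>.
\<close>

lemma torsion_eigenvector:
  fixes p a :: int
  assumes p: "prime p" and root: "p ^ k dvd poly f a" and simple: "\<not> p dvd poly (pderiv f) a"
    and g: "\<not> p dvd poly g a" and lead: "\<not> p dvd lead_coeff f"
    and E: "E \<ge> 1" "act (f ^ E * g) e = 0"
    and \<Delta>: "\<not> p dvd \<Delta>"
      "\<And>q n z. degree q < degree f \<Longrightarrow> z \<in> integral_vecs \<Longrightarrow> act q e - of_int n *s z \<in> W \<Longrightarrow>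
         n dvd coeff q (degree f - 1) * \<Delta>"
  obtains v where "v \<in> ext (degree f)" "of_int (p ^ k) *s v \<in> integral_vecs"
    "act [:-a, 1:] v \<in> lat" "act ([:-a, 1:] ^ E) v \<in> integral_vecs"
    "\<And>h. of_int h *s v \<in> lat \<Longrightarrow> p ^ k dvd h"
proof -
  define fa where "fa = synthetic_div f a"
  define G where "G = fa ^ (E - 1) * g"
  define r :: rat where "r = of_int (p ^ k)"
  have p0: "p \<noteq> 0" using p by auto
  then have r0: "r \<noteq> 0" by (simp add: r_def)
  obtain b where b: "poly f a = p ^ k * b" using root by (auto simp: dvd_def)
  have fa: "[:-a, 1:] * fa = f - [:p ^ k * b:]"
    using synthetic_div_correct'[of a f] unfolding fa_def b by (simp add: algebra_simps)
  have H: "fa ^ E * g = fa * G" using E(1) by (cases E) (auto simp: G_def mult_ac)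
  define v where "v = inverse r *s act (fa ^ E * g) e"
  have rv: "r *s v = act (fa ^ E * g) e" using r0 by (simp add: v_def)
  \<comment> \<open>Since \<open>(x - a) * fa = f - p^k * b\<close> and \<open>f(A) e\<close> lies
    in \<open>W\<close>, the vector \<open>p^-k * fa(A) e\<close> is an eigenvector modulo
    \<open>lat\<close>; \<open>v\<close> will be its image under \<open>G(A)\<close>.\<close>
  have ev: "act [:-a, 1:] (inverse r *s act fa e) \<in> lat"
  proof -
    have "act [:-a, 1:] (inverse r *s act fa e) = inverse r *s act ([:-a, 1:] * fa) e"
      by (simp only: poly_action_mult poly_action_vec_scale)
    also have "\<dots> = inverse r *s act f e - of_int b *s e"
      unfolding fa using p0 by (simp add: poly_action_diff r_def vec.scale_right_diff_distrib field_simps)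
    finally show ?thesis
      by (simp only:) (intro lat_diff lat_scale lat_integral e lat_W vec.subspace_scale[OF subspace] f)
  qed
  have v_eq: "v = act G (inverse r *s act fa e)"
    unfolding v_def H by (simp add: poly_action_vec_scale poly_action_mult poly_action_commute[of _ fa])
  show thesis
  proof (rule that)
    show "v \<in> ext (degree f)"
      unfolding v_def by (intro vec.subspace_scale[OF subspace_ext] act_e_mem_ext)
    show "of_int (p ^ k) *s v \<in> integral_vecs"
      using rv poly_action_integral[OF e(2)] unfolding r_def by metis
    show "act [:-a, 1:] v \<in> lat"
      unfolding v_eq using lat_act[OF ev, of G] by (subst poly_action_commute)
    show "act ([:-a, 1:] ^ E) v \<in> integral_vecs"
    proof -
      \<comment> \<open>The \<open>E\<close>-th powers of \<open>f - p^k * b\<close> and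
        \<open>f\<close> agree modulo \<open>p^k\<close>. As \<open>f^E * g\<close> annihilates
        \<open>e\<close>, what remains has a factor \<open>p^k\<close> that cancels the denominator
        of \<open>v\<close>.\<close>
      have "f - [:p ^ k * b:] - f dvd (f - [:p ^ k * b:]) ^ E - f ^ E"
        by (metis dvd_triv_left power_diff_sumr2)
      then obtain q where q: "(f - [:p ^ k * b:]) ^ E = f ^ E + smult (p ^ k) q"
      proof -
        assume "f - [:p ^ k * b:] - f dvd (f - [:p ^ k * b:]) ^ E - f ^ E"
        then obtain s where "(f - [:p ^ k * b:]) ^ E - f ^ E = (f - [:p ^ k * b:] - f) * s" by (auto simp: dvd_def)
        then have "(f - [:p ^ k * b:]) ^ E = f ^ E + smult (p ^ k) (smult (- b) s)"
          by (simp add: algebra_simps)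
        then show thesis by (rule that)
      qed
      have "r *s act ([:-a, 1:] ^ E) v = act ([:-a, 1:] ^ E * (fa ^ E * g)) e"
        unfolding v_def using r0 by (simp add: poly_action_vec_scale poly_action_mult)
      also have "[:-a, 1:] ^ E * (fa ^ E * g) = (f - [:p ^ k * b:]) ^ E * g"
        unfolding fa[symmetric] by (simp only: power_mult_distrib mult.assoc)
      also have "\<dots> = f ^ E * g + smult (p ^ k) (q * g)"
        unfolding q by (simp add: algebra_simps)
      also have "act \<dots> e = r *s act (q * g) e"
        using E(2) by (simp only: poly_action_add poly_action_smult r_def) simp
      finally have "act ([:-a, 1:] ^ E) v = act (q * g) e"
        using r0 by (simp add: vec.scale_left_imp_eq)
      then show ?thesis using poly_action_integral[OF e(2)] by metis
    qed
    \<comment> \<open>Modulo \<open>lat\<close>, \<open>v\<close> is \<open>G(a)\<close> times the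
      eigenvector. Multiplying by \<open>p^k\<close> gives the form to which the top coefficient
      criterion applies: \<open>p^k\<close> divides \<open>h * G(a)\<close> times the leading
      coefficient times \<open>\<Delta>\<close>.\<close>
    fix h assume h: "of_int h *s v \<in> lat"
    have "v = of_int (poly G a) *s (inverse r *s act fa e)
        + act (synthetic_div G a) (act [:-a, 1:] (inverse r *s act fa e))"
      unfolding v_eq by (rule poly_action_linear_factor)
    then have "of_int h *s v = of_int (h * poly G a) *s (inverse r *s act fa e)
        + of_int h *s act (synthetic_div G a) (act [:-a, 1:] (inverse r *s act fa e))"
      by (simp only: vec.scale_right_distrib vec.scale_scale of_int_mult mult.assoc)
    then have "of_int (h * poly G a) *s (inverse r *s act fa e) =
        of_int h *s v - of_int h *s act (synthetic_div G a) (act [:-a, 1:] (inverse r *s act fa e))"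
      by simp
    also have "\<dots> \<in> lat" by (intro lat_diff h lat_scale lat_act ev)
    finally obtain z where z: "z \<in> integral_vecs"
      "of_int (h * poly G a) *s (inverse r *s act fa e) - z \<in> W"
      unfolding lat_def by blast
    have "r *s (of_int (h * poly G a) *s (inverse r *s act fa e) - z) \<in> W"
      by (intro vec.subspace_scale[OF subspace] z)
    moreover have "r *s (of_int (h * poly G a) *s (inverse r *s act fa e) - z) =
        act (smult (h * poly G a) fa) e - of_int (p ^ k) *s z"
      using r0 unfolding poly_action_smult r_def[symmetric]
      by (simp add: vec.scale_right_diff_distrib mult.left_commute)
    ultimately have W: "act (smult (h * poly G a) fa) e - of_int (p ^ k) *s z \<in> W" by simp
    have deg_fa: "degree fa = degree f - 1" by (simp add: fa_def degree_synthetic_div)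
    have "degree (smult (h * poly G a) fa) < degree f"
      using degree_smult_le[of "h * poly G a" fa] deg_fa degree_f_pos by linarith
    from \<Delta>(2)[OF this z(1) W]
    have "p ^ k dvd h * poly G a * coeff fa (degree f - 1) * \<Delta>" by simp
    also have "coeff fa (degree f - 1) = lead_coeff f"
    proof -
      have "coeff f (degree f) = coeff ([:-a, 1:] * fa + [:poly f a:]) (degree f)"
        unfolding fa_def by (simp only: synthetic_div_correct')
      also have "\<dots> = coeff fa (degree f - 1)"
        using degree_f_pos deg_fa by (cases "degree f") (auto simp: coeff_eq_0)
      finally show ?thesis by simp
    qed
    finally have *: "p ^ k dvd h * (poly G a * lead_coeff f * \<Delta>)" by (simp add: mult_ac)
    \<comment> \<open>\<open>fa(a) = f'(a)\<close>, so simplicity of the root and the hypothesis on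
      \<open>g(a)\<close> make \<open>G(a)\<close> a unit modulo \<open>p\<close>.\<close>
    have "\<not> p dvd poly fa a" using simple unfolding fa_def poly_synthetic_div_self .
    then have "\<not> p dvd poly G a"
      using g p by (simp add: G_def prime_dvd_mult_iff) (metis prime_dvd_power)
    then have "\<not> p dvd poly G a * lead_coeff f * \<Delta>"
      using lead \<Delta>(1) p by (simp add: prime_dvd_mult_iff)
    then have "coprime (p ^ k) (poly G a * lead_coeff f * \<Delta>)"
      using prime_imp_coprime[OF p] coprime_power_left_iff by blast
    then show "p ^ k dvd h" using * by (simp only: coprime_dvd_mult_left_iff)
  qed
qed

text \<open>A return in the quotient is a return of \<open>v\<close> itself up to the bounded
  denominator \<open>p^c\<close>. Expand \<open>((x - a) + a)^m\<close>: the term 0 is settled by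
  the congruence, terms from \<open>E\<close> on are integral, and for \<open>0 < l < E < p\<close>
  the identity \<open>l * (m choose l) = m * (m - 1 choose l - 1)\<close> passes the divisibility of
  \<open>m\<close> on to the coefficient.\<close>

lemma binomial_torsion:
  fixes p a :: int
  assumes p: "prime p" "int E < p" and v: "of_int (p ^ k) *s v \<in> integral_vecs" "act ([:-a, 1:] ^ E) v \<in> integral_vecs"
    and m: "p ^ (k - c) dvd int m" "p ^ k dvd a ^ m - 1"
  shows "of_int (p ^ c) *s ((T ^^ m) v - v) \<in> integral_vecs"
proof -
  let ?L = "[:-a, 1:] :: int poly"
  have int: "of_int n *s act q v \<in> integral_vecs" if "p ^ k dvd n" for n q
  proof -
    from that obtain n' where "n = n' * p ^ k" by (metis dvdE mult.commute)
    then have "of_int n *s act q v = act (smult n' q) (of_int (p ^ k) *s v)"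
      by (simp add: poly_action_smult poly_action_vec_scale mult_ac)
    then show ?thesis using poly_action_integral[OF v(1)] by metis
  qed
  have "monom 1 m = (?L + [:a:]) ^ m" by (simp add: monom_altdef)
  also have "\<dots> = (\<Sum>l\<le>m. of_nat (m choose l) * ?L ^ l * [:a:] ^ (m - l))"
    by (rule binomial_ring)
  also have "\<dots> = (\<Sum>l\<le>m. smult (int (m choose l) * a ^ (m - l)) (?L ^ l))"
    by (intro sum.cong) (auto simp: of_nat_poly poly_const_pow mult_ac)
  finally have mon: "monom 1 m = (\<Sum>l\<le>m. smult (int (m choose l) * a ^ (m - l)) (?L ^ l))" .
  have act_sum: "act (sum F I) x = (\<Sum>i\<in>I. act (F i) x)" for F :: "nat \<Rightarrow> int poly" and I x
    by (induction I rule: infinite_finite_induct) (auto simp: poly_action_add)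
  have "(T ^^ m) v = act (monom 1 m) v" by (simp add: poly_action_monom)
  also have "\<dots> = (\<Sum>l\<le>m. of_int (int (m choose l) * a ^ (m - l)) *s act (?L ^ l) v)"
    unfolding mon by (simp only: act_sum poly_action_smult)
  also have "\<dots> = of_int (a ^ m) *s v + (\<Sum>l\<in>{1..m}. of_int (int (m choose l) * a ^ (m - l)) *s act (?L ^ l) v)"
    by (simp add: sum.atMost_shift atLeast0AtMost[symmetric] sum.atLeast_Suc_atMost del: of_int_mult)
  finally have "of_int (p ^ c) *s ((T ^^ m) v - v) = of_int (p ^ c * (a ^ m - 1)) *s act 1 v +
      (\<Sum>l\<in>{1..m}. of_int (p ^ c * (int (m choose l) * a ^ (m - l))) *s act (?L ^ l) v)"
    by (simp add: vec.scale_right_distrib vec.scale_right_diff_distrib vec.scale_sum_right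
        vec.scale_left_diff_distrib algebra_simps)
  also have "\<dots> \<in> integral_vecs"
  proof (intro integral_vecs_add integral_vecs_sum)
    show "of_int (p ^ c * (a ^ m - 1)) *s act 1 v \<in> integral_vecs"
      by (rule int) (use m in simp)
    fix l assume l: "l \<in> {1..m}"
    show "of_int (p ^ c * (int (m choose l) * a ^ (m - l))) *s act (?L ^ l) v \<in> integral_vecs"
    proof (cases "l \<ge> E")
      case True
      then have "?L ^ l = ?L ^ (l - E) * ?L ^ E" by (simp flip: power_add)
      then have "act (?L ^ l) v = act (?L ^ (l - E)) (act (?L ^ E) v)" by (simp only: poly_action_mult)
      then show ?thesis using poly_action_integral[OF v(2)] integral_vecs_scale by metis
    next
      case False
      have "int l * int (m choose l) = int m * int ((m - 1) choose (l - 1))"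
        using l binomial_absorption[of "l - 1" m] by (simp flip: of_nat_mult)
      then have "p ^ (k - c) dvd int l * int (m choose l)" using m(1) by simp
      moreover have "\<not> p dvd int l" using l False p zdvd_imp_le[of p "int l"] by auto
      then have "coprime (p ^ (k - c)) (int l)" using p(1) by (simp add: prime_imp_coprime)
      ultimately have "p ^ (k - c) dvd int (m choose l)" by (simp add: coprime_dvd_mult_right_iff)
      then have "p ^ c * p ^ (k - c) dvd p ^ c * int (m choose l)" by simp
      moreover have "p ^ k dvd p ^ c * p ^ (k - c)"
        unfolding power_add[symmetric] by (rule le_imp_power_dvd) simp
      ultimately have "p ^ k dvd p ^ c * (int (m choose l) * a ^ (m - l))"
        by (metis dvd_mult2 dvd_trans mult.assoc)
      then show ?thesis by (rule int)
    qed
  qed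
  finally show ?thesis .
qed

end

section \<open>Separated orbits\<close>

text \<open>
  The multiplier \<open>t\<close> absorbs the bounded denominators that arise when one descends from a larger
  subspace; those denominators are powers of primes exceeding \<open>Q\<close>.
\<close>

definition (in aperiodic_matrix) separated :: "(rat ^ 'n) set \<Rightarrow> nat \<Rightarrow> bool" where
  "separated W \<delta> \<longleftrightarrow> (\<exists>Q c. c > 0 \<and> (\<forall>M\<ge>1. \<exists>v\<in>W. \<exists>N B :: nat.
     N > 0 \<and> coprime (int N) (det A) \<and> of_nat N *s v \<in> integral_vecs \<and>
     (\<forall>q. prime q \<longrightarrow> q dvd B \<longrightarrow> q \<le> Q) \<and> c * of_nat M ^ \<delta> \<le> (of_nat B :: rat) \<and>
     (\<forall>t j m. \<forall>z\<in>integral_vecs. coprime t (fact Q :: int) \<longrightarrow>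
        (let l = of_int t *s ((T ^^ (j + m)) v - (T ^^ j) v) - z in
          (l = 0 \<longrightarrow> B dvd m) \<and> (l \<noteq> 0 \<longrightarrow> (\<exists>i. c / of_nat M \<le> \<bar>l $ i\<bar>))))))"

text \<open>For \<open>v = 0\<close> the nonzero differences are nonzero integral vectors, of size
  at least \<open>1 \<ge> 1 / M\<close>.\<close>

lemma (in aperiodic_matrix) separated_0: "separated {0} 0"
  unfolding separated_def
proof (rule exI[of _ 0], rule exI[of _ 1], intro conjI allI impI)
  fix M :: nat assume M: "M \<ge> 1"
  have T0: "(T ^^ i) 0 = 0" for i by (induction i) auto
  have l: "\<exists>i. 1 / of_nat M \<le> \<bar>z $ i\<bar>" if z: "z \<in> integral_vecs" "z \<noteq> 0" for z :: "rat ^ 'n"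
  proof -
    from z(2) obtain i where "z $ i \<noteq> 0" by (auto simp: vec_eq_iff)
    then have "\<bar>z $ i\<bar> \<ge> 1" by (rule integral_vecs_component_ge_1[OF z(1)])
    moreover have "(1 :: rat) / of_nat M \<le> 1" using M by simp
    ultimately show ?thesis by (meson order_trans)
  qed
  show "\<exists>v\<in>{0}. \<exists>N B :: nat. N > 0 \<and> coprime (int N) (det A) \<and> of_nat N *s v \<in> integral_vecs \<and>
     (\<forall>q. prime q \<longrightarrow> q dvd B \<longrightarrow> q \<le> 0) \<and> 1 * of_nat M ^ 0 \<le> (of_nat B :: rat) \<and>
     (\<forall>t j m. \<forall>z\<in>integral_vecs. coprime t (fact 0 :: int) \<longrightarrow>
        (let l = of_int t *s ((T ^^ (j + m)) v - (T ^^ j) v) - z in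
          (l = 0 \<longrightarrow> B dvd m) \<and> (l \<noteq> 0 \<longrightarrow> (\<exists>i. 1 / of_nat M \<le> \<bar>l $ i\<bar>))))"
    by (rule bexI[of _ 0], rule exI[of _ 1], rule exI[of _ 1]) (auto simp: T0 Let_def l)
qed simp

section \<open>One step up the flag\<close>

context minimal_extension
begin

text \<open>The constant \<open>c\<close> is uniform in \<open>k\<close> and \<open>a\<close>. By
  aperiodicity \<open>x^s - 1\<close> is injective on vectors, hence coprime to \<open>f\<close> up
  to an integer \<open>R\<close>. A \<open>p^c\<close> not dividing \<open>R\<close> cannot divide
  \<open>a^s - 1\<close> when it divides \<open>f(a)\<close>, so lifting the exponent applies to
  \<open>a^s\<close>.\<close>

lemma power_eq_1_bound:
  assumes p: "prime (p :: int)" "p > 2" "coprime a0 p"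
  obtains c where "\<And>k a m. p ^ k dvd poly f a \<Longrightarrow> [a = a0] (mod p) \<Longrightarrow> p ^ k dvd a ^ m - 1 \<Longrightarrow>
    p ^ (k - c) dvd int m"
proof -
  have "p > 0" using p(2) by simp
  obtain s where s: "s > 0" "[a0 ^ s = 1] (mod p)"
    by (rule exists_power_cong_1[OF p(3) \<open>p > 0\<close>])
  have "act (monom 1 s - 1) e \<notin> W"
  proof
    assume "act (monom 1 s - 1) e \<in> W"
    moreover have "x = 0" if "act (monom 1 s - 1) x = 0" for x
      using that aperiodic[OF s(1)] by (simp add: poly_action_diff poly_action_monom)
    ultimately have "e \<in> W" using mem_subspace_if_act_mem[OF subspace invariant] by blast
    then show False using e by simp
  qed
  then obtain U V R where R: "R \<noteq> 0" "U * f + V * (monom 1 s - 1) = [:R:]" by (rule bezout)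
  obtain c where c: "\<not> p ^ c dvd R"
  proof -
    have "is_unit p \<longleftrightarrow> False" using p(1) by auto
    then have "finite {n. p ^ n dvd R}" using R(1) finite_divisor_powers by blast
    then show thesis using that infinite_UNIV_nat by (metis (mono_tags, lifting) UNIV_eq_I mem_Collect_eq)
  qed
  show thesis
  proof (rule that)
    fix k a m assume a: "p ^ k dvd poly f a" "[a = a0] (mod p)" "p ^ k dvd a ^ m - 1"
    show "p ^ (k - c) dvd int m"
    proof (cases "k \<le> c")
      case True
      then show ?thesis by simp
    next
      case False
      show ?thesis
      proof (rule lifting_the_exponent_dvd[OF p(1)])
        show "odd p" using p prime_odd_int by blast
        have "[a ^ s = 1] (mod p)" using cong_pow[OF a(2), of s] s(2) by (rule cong_trans)
        then show "p dvd a ^ s - 1" by (simp add: cong_iff_dvd_diff)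
        show "\<not> p ^ c dvd a ^ s - 1"
        proof
          assume *: "p ^ c dvd a ^ s - 1"
          have "p ^ c dvd poly f a" using a(1) False by (meson dvd_trans le_imp_power_dvd nat_le_linear)
          moreover have "R = poly U a * poly f a + poly V a * (a ^ s - 1)"
            using arg_cong[OF R(2), of "\<lambda>q. poly q a"] by (simp add: poly_monom)
          ultimately show False using * c by (metis dvd_add dvd_mult)
        qed
        have "a ^ m - 1 dvd (a ^ m) ^ s - 1" by (metis dvd_triv_left power_diff_1_eq)
        then show "p ^ k dvd (a ^ s) ^ m - 1" using a(3) by (metis dvd_trans power_commutes power_mult mult.commute)
      qed
    qed
  qed
qed

text \<open>The vector \<open>P h(A) l\<close> is integral and at most \<open>K * L * M\<close>
  times as large as \<open>l\<close>. If \<open>l\<close> were too small it would vanish, putting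
  \<open>h(A) l\<close> into \<open>W\<close> against minimality for \<open>l\<close>.\<close>

lemma separation_modulo_W:
  obtains c :: rat where "c > 0"
    "\<And>M h l. M \<ge> 1 \<Longrightarrow> h \<noteq> 0 \<Longrightarrow> degree h < degree f \<Longrightarrow> (\<And>j. \<bar>coeff h j\<bar> \<le> int M) \<Longrightarrow>
       act h l \<in> lat \<Longrightarrow> l \<notin> W \<Longrightarrow> \<exists>i. c / of_nat M \<le> \<bar>l $ i\<bar>"
proof -
  obtain P :: "rat ^ 'n ^ 'n" where P: "\<And>x. P *v x = 0 \<longleftrightarrow> x \<in> W"
    "\<And>z. z \<in> integral_vecs \<Longrightarrow> P *v z \<in> integral_vecs"
    by (rule integral_matrix_with_kernel[OF subspace]) blast
  obtain K where K: "K > 0" "\<And>x \<epsilon> i. (\<And>j. \<bar>x $ j\<bar> \<le> \<epsilon>) \<Longrightarrow> \<bar>(P *v x) $ i\<bar> \<le> K * \<epsilon>"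
    by (rule matrix_sup_bound[of P]) blast
  obtain L where L: "L > 0" "\<And>h x \<epsilon> M i. degree h < degree f \<Longrightarrow> (\<And>j. \<bar>coeff h j\<bar> \<le> int M) \<Longrightarrow>
      (\<And>j. \<bar>x $ j\<bar> \<le> \<epsilon>) \<Longrightarrow> \<bar>act h x $ i\<bar> \<le> L * of_nat M * \<epsilon>"
    by (rule poly_action_sup_bound[of "degree f" "rat_mat A"]) blast
  define c where "c = 1 / (2 * K * L)"
  show thesis
  proof (rule that)
    show "c > 0" using K(1) L(1) by (simp add: c_def)
    fix M h l
    assume M: "M \<ge> 1" and h: "h \<noteq> 0" "degree h < degree f" "\<And>j. \<bar>coeff h j\<bar> \<le> int M"
      and l: "act h l \<in> lat" "l \<notin> W"
    show "\<exists>i. c / of_nat M \<le> \<bar>l $ i\<bar>"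
    proof (rule ccontr)
      assume "\<not> ?thesis"
      then have "\<bar>l $ j\<bar> \<le> c / of_nat M" for j by (simp add: not_le less_imp_le)
      then have "\<bar>act h l $ i\<bar> \<le> L * of_nat M * (c / of_nat M)" for i
        by (intro L(2) h)
      then have "\<bar>(P *v act h l) $ i\<bar> \<le> K * (L * of_nat M * (c / of_nat M))" for i
        by (intro K(2))
      moreover have "K * (L * of_nat M * (c / of_nat M)) = 1 / 2"
        using M K(1) L(1) by (simp add: c_def)
      ultimately have "\<bar>(P *v act h l) $ i\<bar> \<le> 1 / 2" for i by metis
      then have small: "\<bar>(P *v act h l) $ i\<bar> < 1" for i
        by (rule le_less_trans) simp
      from l(1) obtain z where z: "z \<in> integral_vecs" "act h l - z \<in> W" unfolding lat_def by blast
      have "P *v (act h l - z) = 0" using P(1) z(2) by blast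
      then have "P *v act h l = P *v z" by (simp add: vec.diff)
      then have int: "P *v act h l \<in> integral_vecs" using P(2) z(1) by metis
      have "P *v act h l = 0"
        using integral_vecs_component_ge_1[OF int] small by (metis not_le vec_eq_iff zero_index)
      then have "act h l \<in> W" using P(1) by blast
      then show False using minimal[OF l(2) h(1,2)] by blast
    qed
  qed
qed

text \<open>A point \<open>u\<close> of order \<open>p^k\<close> is added to the old point
  \<open>v'\<close> in \<open>W\<close>. Differences outside \<open>W\<close> are bounded through
  the quotient; those inside \<open>W\<close>, multiplied by \<open>p^c0\<close>, are differences
  for \<open>v'\<close> again.\<close>

lemma separated_ext:
  assumes "separated W \<delta>"
  shows "separated (ext (degree f)) (\<delta> + degree f)"
proof -
  let ?d = "degree f"
  from assms obtain Q c where c: "c > 0" and sep: "\<And>M. M \<ge> 1 \<Longrightarrow> \<exists>v\<in>W. \<exists>N B :: nat.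
     N > 0 \<and> coprime (int N) (det A) \<and> of_nat N *s v \<in> integral_vecs \<and>
     (\<forall>q. prime q \<longrightarrow> q dvd B \<longrightarrow> q \<le> Q) \<and> c * of_nat M ^ \<delta> \<le> (of_nat B :: rat) \<and>
     (\<forall>t j m. \<forall>z\<in>integral_vecs. coprime t (fact Q :: int) \<longrightarrow>
        (let l = of_int t *s ((T ^^ (j + m)) v - (T ^^ j) v) - z in
          (l = 0 \<longrightarrow> B dvd m) \<and> (l \<noteq> 0 \<longrightarrow> (\<exists>i. c / of_nat M \<le> \<bar>l $ i\<bar>))))"
    unfolding separated_def by blast
  obtain E g where E: "E \<ge> 1" "act (f ^ E * g) e = 0" "act g e \<notin> W"
    by (rule annihilating_factorization)
  obtain U V R where R: "R \<noteq> 0" "U * f + V * g = [:R:]" using E(3) by (rule bezout)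
  \<comment> \<open>In characteristic zero the derivative is nonzero of smaller degree, so it is
    coprime to \<open>f\<close>, and roots modulo primes not dividing \<open>R'\<close> are
    simple.\<close>
  have "act (pderiv f) e \<notin> W"
    using minimal[OF e(1), of "pderiv f"] degree_f_pos by (simp add: pderiv_eq_0_iff degree_pderiv)
  then obtain U' V' R' where R': "R' \<noteq> 0" "U' * f + V' * pderiv f = [:R':]" by (rule bezout)
  obtain \<Delta> where \<Delta>: "\<Delta> \<noteq> 0"
    "\<And>q n z. degree q < degree f \<Longrightarrow> z \<in> integral_vecs \<Longrightarrow> act q e - of_int n *s z \<in> W \<Longrightarrow>
       n dvd coeff q (degree f - 1) * \<Delta>"
    by (rule top_coeff_detector) blast
  \<comment> \<open>What \<open>p\<close> must not divide: \<open>R\<close> so that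
    \<open>g(a)\<close> is a unit, \<open>R'\<close> for a simple root, \<open>\<Delta>\<close> and
    the leading coefficient for the full order of \<open>u\<close>, \<open>f(0)\<close> so that the
    root is a unit, \<open>det A\<close> to keep \<open>N\<close> coprime to it.\<close>
  define X where "X = R * R' * \<Delta> * lead_coeff f * poly f 0 * det A"
  have X: "X \<noteq> 0" using R(1) R'(1) \<Delta>(1) f(1) poly_f_0 det_nonzero by (simp add: X_def)
  \<comment> \<open>\<open>p > Q\<close> makes \<open>p\<close> coprime to \<open>B'\<close> and
    \<open>Q!\<close>, \<open>p > E\<close> serves the binomial argument, and \<open>p > 2\<close>
    serves lifting the exponent.\<close>
  obtain p :: nat and a0 where p: "prime p" "p > Q + E + 2 + nat \<bar>X\<bar>" "int p dvd poly f a0"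
    by (rule exists_prime_dvd_poly_value[OF degree_f_pos poly_f_0])
  have pQ: "p > Q" "p > E" "p > 2" using p(2) by auto
  have pi: "prime (int p)" using p(1) by simp
  have pX: "\<not> int p dvd X"
  proof
    assume "int p dvd X"
    then have "int p \<le> \<bar>X\<bar>" using dvd_imp_le_int[OF X] by fastforce
    then show False using p(2) by linarith
  qed
  have ndvd: "\<not> int p dvd R" "\<not> int p dvd R'" "\<not> int p dvd \<Delta>" "\<not> int p dvd lead_coeff f"
      "\<not> int p dvd poly f 0" "\<not> int p dvd det A"
    using pX unfolding X_def by (auto simp: dvd_mult dvd_mult2)
  have not_dvd: "\<not> int p dvd poly h a" if "int p dvd poly f a" "U * f + V * h = [:R:]" "\<not> int p dvd R" for h a U V R
  proof
    assume "int p dvd poly h a"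
    moreover have "R = poly U a * poly f a + poly V a * poly h a"
      using arg_cong[OF that(2), of "\<lambda>q. poly q a"] by simp
    ultimately show False using that by (metis dvd_add dvd_mult)
  qed
  have "\<not> int p dvd a0"
  proof
    assume "int p dvd a0"
    then have "[poly f a0 = poly f 0] (mod int p)" by (intro cong_poly) (simp add: cong_0_iff)
    then show False using p(3) ndvd(5) by (simp add: cong_dvd_iff)
  qed
  then have a0: "coprime a0 (int p)" using pi by (metis coprime_commute prime_imp_coprime)
  obtain c0 where c0: "\<And>k a m. int p ^ k dvd poly f a \<Longrightarrow> [a = a0] (mod int p) \<Longrightarrow>
      int p ^ k dvd a ^ m - 1 \<Longrightarrow> int p ^ (k - c0) dvd int m"
    using power_eq_1_bound[OF pi _ a0] pQ(3) by (metis of_nat_less_iff of_nat_numeral)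
  obtain c1 :: rat where c1: "c1 > 0"
    "\<And>M h l. M \<ge> 1 \<Longrightarrow> h \<noteq> 0 \<Longrightarrow> degree h < degree f \<Longrightarrow> (\<And>j. \<bar>coeff h j\<bar> \<le> int M) \<Longrightarrow>
       act h l \<in> lat \<Longrightarrow> l \<notin> W \<Longrightarrow> \<exists>i. c1 / of_nat M \<le> \<bar>l $ i\<bar>"
    by (rule separation_modulo_W) blast
  \<comment> \<open>A factor \<open>p^c0\<close> is lost on descending to \<open>W\<close>, both in
    the period and in the separation, and one more \<open>p\<close> because \<open>p^k\<close> only
    approximates \<open>M^d\<close>.\<close>
  define c' where "c' = min c1 (c / of_nat p ^ (c0 + 1))"
  have p0: "p > 0" using pQ by simp
  have c': "c' > 0" "c' \<le> c1" "c' \<le> c / of_nat p ^ (c0 + 1)"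
    using c c1(1) p0 by (auto simp: c'_def)
  show ?thesis
    unfolding separated_def
  proof (intro exI[of _ p] exI[of _ c'] conjI allI impI c')
    fix M :: nat assume M: "M \<ge> 1"
    obtain v' N' B' where v': "v' \<in> W" "N' > 0" "coprime (int N') (det A)" "of_nat N' *s v' \<in> integral_vecs"
      and B': "\<And>q. prime q \<Longrightarrow> q dvd B' \<Longrightarrow> q \<le> Q" "c * of_nat M ^ \<delta> \<le> (of_nat B' :: rat)"
      and sep': "\<And>t j m z. z \<in> integral_vecs \<Longrightarrow> coprime t (fact Q :: int) \<Longrightarrow>
        (of_int t *s ((T ^^ (j + m)) v' - (T ^^ j) v') - z = 0 \<longrightarrow> B' dvd m) \<and>
        (of_int t *s ((T ^^ (j + m)) v' - (T ^^ j) v') - z \<noteq> 0 \<longrightarrow>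
          (\<exists>i. c / of_nat M \<le> \<bar>(of_int t *s ((T ^^ (j + m)) v' - (T ^^ j) v') - z) $ i\<bar>))"
      using sep[OF M] unfolding Let_def by blast
    \<comment> \<open>The upper bound on \<open>p^k\<close> feeds the pigeonhole for
      \<open>h\<close>; the lower bound makes the period large.\<close>
    obtain k where k: "p ^ k \<le> M ^ ?d" "M ^ ?d < p ^ (k + 1)"
      using ex_power_ivl1[of p "M ^ ?d"] pQ(3) M by auto
    obtain a where a: "[a = a0] (mod int p)" "int p ^ k dvd poly f a"
      using hensel_lifting[OF pi p(3) not_dvd[OF p(3) R'(2) ndvd(2)]] by blast
    have fa: "int p dvd poly f a" using cong_dvd_iff[OF cong_poly[OF a(1)]] p(3) by blast
    have pa: "\<not> int p dvd a" using a(1) \<open>\<not> int p dvd a0\<close> by (simp add: cong_dvd_iff)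
    obtain u where u: "u \<in> ext ?d" "of_int (int p ^ k) *s u \<in> integral_vecs" "act [:-a, 1:] u \<in> lat"
      "act ([:-a, 1:] ^ E) u \<in> integral_vecs" "\<And>h. of_int h *s u \<in> lat \<Longrightarrow> int p ^ k dvd h"
      by (rule torsion_eigenvector[OF pi a(2) not_dvd[OF fa R'(2) ndvd(2)] not_dvd[OF fa R(2) ndvd(1)]
            ndvd(4) E(1,2) ndvd(3) \<Delta>(2)]) blast+
    obtain h where h: "h \<noteq> 0" "degree h < ?d" "\<And>i. \<bar>coeff h i\<bar> \<le> int M" "int (p ^ k) dvd poly h a"
      using exists_small_poly_root_mod[of "p ^ k" ?d M a] p0 degree_f_pos k(1) by auto
    define v where "v = v' + u"
    define N where "N = N' * p ^ k"
    define B where "B = B' * p ^ (k - c0)"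
    \<comment> \<open>Modulo \<open>lat\<close>, \<open>q\<close> acts on \<open>u\<close> as the
      scalar \<open>q(a)\<close>. As \<open>p^k\<close> divides \<open>h(a)\<close> and
      \<open>v'\<close> lies in \<open>W\<close>, \<open>h\<close> sends \<open>v\<close> into
      \<open>lat\<close>.\<close>
    have act_u: "act q u - of_int (poly q a) *s u \<in> lat" for q
      using poly_action_linear_factor[of "rat_mat A" q u a] lat_act[OF u(3)] by simp
    have hu: "act h v \<in> lat"
    proof -
      from h(4) obtain b where b: "poly h a = b * int p ^ k" by (metis dvdE mult.commute of_nat_power)
      have "of_int (poly h a) *s u = of_int b *s (of_int (int p ^ k) *s u)" by (simp add: b)
      then have "of_int (poly h a) *s u \<in> lat" using u(2) by (simp only: lat_scale lat_integral)
      then have "act h u \<in> lat" using lat_add[OF act_u[of h]] by fastforce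
      then show ?thesis unfolding v_def poly_action_vec_add by (rule lat_add[OF lat_W[OF act_W[OF v'(1)]]])
    qed
    show "\<exists>v\<in>ext ?d. \<exists>N B :: nat. N > 0 \<and> coprime (int N) (det A) \<and> of_nat N *s v \<in> integral_vecs \<and>
       (\<forall>q. prime q \<longrightarrow> q dvd B \<longrightarrow> q \<le> p) \<and> c' * of_nat M ^ (\<delta> + ?d) \<le> (of_nat B :: rat) \<and>
       (\<forall>t j m. \<forall>z\<in>integral_vecs. coprime t (fact p :: int) \<longrightarrow>
          (let l = of_int t *s ((T ^^ (j + m)) v - (T ^^ j) v) - z in
            (l = 0 \<longrightarrow> B dvd m) \<and> (l \<noteq> 0 \<longrightarrow> (\<exists>i. c' / of_nat M \<le> \<bar>l $ i\<bar>))))"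
    proof (rule bexI[of _ v], rule exI[of _ N], rule exI[of _ B], intro conjI allI impI ballI)
      show "v \<in> ext ?d"
        unfolding v_def using W_subset_ext v'(1) u(1) by (intro vec.subspace_add[OF subspace_ext]) auto
      show "N > 0" using v'(2) p0 by (simp add: N_def)
      have "coprime (int p) (det A)" using pi ndvd(6) by (simp add: prime_imp_coprime)
      then show "coprime (int N) (det A)" using v'(3) by (simp add: N_def)
      have "of_nat N *s v = of_int (int p ^ k) *s (of_nat N' *s v') + of_int (int N') *s (of_int (int p ^ k) *s u)"
        by (simp add: N_def v_def vec.scale_right_distrib mult_ac)
      then show "of_nat N *s v \<in> integral_vecs"
        using v'(4) u(2) by (simp only: integral_vecs_add integral_vecs_scale)
      show "q \<le> p" if q: "prime q" "q dvd B" for q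
      proof (cases "q dvd B'")
        case True
        then show ?thesis using B'(1)[OF q(1)] pQ(1) by simp
      next
        case False
        then have "q dvd p ^ (k - c0)" using q by (simp add: B_def prime_dvd_mult_iff)
        then have "q dvd p" using q(1) prime_dvd_power by blast
        then show ?thesis using p0 dvd_imp_le by blast
      qed
      show "c' * of_nat M ^ (\<delta> + ?d) \<le> (of_nat B :: rat)"
      proof -
        have "M ^ ?d \<le> p ^ (c0 + 1) * p ^ (k - c0)"
        proof -
          have "p ^ (k + 1) \<le> p ^ (c0 + 1 + (k - c0))" using p0 by (intro power_increasing) auto
          then have "M ^ ?d \<le> p ^ (c0 + 1 + (k - c0))" using k(2) by linarith
          then show ?thesis by (simp only: power_add)
        qed
        then have "of_nat (M ^ ?d) \<le> (of_nat (p ^ (c0 + 1) * p ^ (k - c0)) :: rat)"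
          by (simp only: of_nat_le_iff)
        then have Md: "of_nat M ^ ?d \<le> (of_nat p ^ (c0 + 1) * of_nat p ^ (k - c0) :: rat)" by simp
        have "c' * of_nat M ^ (\<delta> + ?d) = c' * (of_nat M ^ \<delta> * of_nat M ^ ?d)" by (simp add: power_add)
        also have "\<dots> \<le> c / of_nat p ^ (c0 + 1) * (of_nat M ^ \<delta> * (of_nat p ^ (c0 + 1) * of_nat p ^ (k - c0)))"
          using c'(3) c'(1) c Md by (intro mult_mono) auto
        also have "\<dots> = c * of_nat M ^ \<delta> * of_nat p ^ (k - c0)" using p0 by simp
        also have "\<dots> \<le> of_nat B' * of_nat p ^ (k - c0)" using B'(2) by (intro mult_right_mono) auto
        finally show ?thesis by (simp add: B_def)
      qed
    next
      fix t :: int and j m and z :: "rat ^ 'n"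
      assume z: "z \<in> integral_vecs" and t: "coprime t (fact p :: int)"
      define q where "q = smult t (monom 1 (j + m) - monom 1 j)"
      have act_q: "act q x = of_int t *s ((T ^^ (j + m)) x - (T ^^ j) x)" for x
        by (simp add: q_def poly_action_smult poly_action_diff poly_action_monom)
      define l where "l = act q v - z"
      have "(l = 0 \<longrightarrow> B dvd m) \<and> (l \<noteq> 0 \<longrightarrow> (\<exists>i. c' / of_nat M \<le> \<bar>l $ i\<bar>))"
      proof (cases "l \<in> W")
        \<comment> \<open>Polynomials in \<open>A\<close> commute, so \<open>h\<close> sends the
          lift \<open>l\<close> into \<open>lat\<close> as well.\<close>
        case False
        have "act h l = act q (act h v) - act h z"
          unfolding l_def poly_action_vec_diff by (simp add: poly_action_commute)
        also have "\<dots> \<in> lat" using z by (intro lat_diff lat_act hu lat_integral)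
        finally obtain i where "c1 / of_nat M \<le> \<bar>l $ i\<bar>" using c1(2)[OF M h(1,2,3) _ False] by blast
        moreover have "c' / of_nat M \<le> c1 / of_nat M" using c'(2) by (simp add: divide_right_mono)
        ultimately show ?thesis using False vec.subspace_0[OF subspace] order_trans by blast
      next
        \<comment> \<open>Here \<open>q(a) * u\<close> lies in \<open>lat\<close>, so the order of
          \<open>u\<close> gives \<open>a^m = 1\<close> modulo \<open>p^k\<close>, as
          \<open>t\<close> and \<open>a\<close> are units. Hence \<open>p^(k - c0)\<close> divides
          \<open>m\<close>, and \<open>p^c0 * q(A) u\<close> is integral.\<close>
        case True
        have "of_int (poly q a) *s u = l - act q v' + z - (act q u - of_int (poly q a) *s u)"
          by (simp add: l_def v_def poly_action_vec_add)
        also have "\<dots> \<in> lat"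
          using True z v'(1) by (intro lat_diff lat_add lat_W act_u act_W lat_integral)
        finally have "int p ^ k dvd poly q a" by (rule u(5))
        also have "poly q a = (t * a ^ j) * (a ^ m - 1)" by (simp add: q_def poly_monom power_add algebra_simps)
        finally have "int p ^ k dvd (t * a ^ j) * (a ^ m - 1)" .
        moreover have "\<not> int p dvd t"
        proof
          assume "int p dvd t"
          moreover have "int p dvd fact p" using p0 by (metis dvd_fact int_dvd_int_iff of_nat_fact le_refl One_nat_def Suc_leI)
          ultimately have "is_unit (int p)" using t by (meson coprime_common_divisor)
          then show False using pi by auto
        qed
        then have "\<not> int p dvd t * a ^ j" using pa pi by (metis prime_dvd_mult_iff prime_dvd_power)
        then have "coprime (int p ^ k) (t * a ^ j)"
          using prime_imp_coprime[OF pi] coprime_power_left_iff by blast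
        ultimately have am: "int p ^ k dvd a ^ m - 1" by (simp only: coprime_dvd_mult_right_iff)
        have pm: "int p ^ (k - c0) dvd int m" by (rule c0[OF a(2,1) am])
        define y where "y = of_int (int p ^ c0) *s act q u"
        have "y = act (smult t (monom 1 j)) (of_int (int p ^ c0) *s ((T ^^ m) u - u))"
          by (simp only: y_def act_q poly_action_smult poly_action_monom funpow_matrix_scale funpow_matrix_diff
              funpow_add o_apply) (simp add: mult_ac)
        then have y: "y \<in> integral_vecs"
          using binomial_torsion[OF pi _ u(2,4) pm am] pQ(2) poly_action_integral by auto
        \<comment> \<open>The integral \<open>y\<close> joins the lattice shift, leaving a
          difference for \<open>v'\<close> with multiplier \<open>t * p^c0\<close>.\<close>
        have eq: "of_int (int p ^ c0) *s l = of_int (t * int p ^ c0) *s ((T ^^ (j + m)) v' - (T ^^ j) v')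
            - (of_int (int p ^ c0) *s z - y)"
          by (simp add: l_def v_def y_def act_q poly_action_vec_add vec_eq_iff algebra_simps)
        have "coprime (int p) (fact Q)"
        proof -
          have "\<not> p dvd fact Q" using p(1) pQ(1) by (simp add: prime_dvd_fact_iff)
          then have "coprime p (fact Q)" using p(1) by (simp add: prime_imp_coprime)
          then show ?thesis by (metis coprime_int_iff of_nat_fact)
        qed
        moreover have "coprime t (fact Q)"
          using t pQ(1) by (meson coprime_divisors dvd_refl fact_dvd less_imp_le)
        ultimately have "coprime (t * int p ^ c0) (fact Q)" by simp
        from sep'[OF integral_vecs_diff[OF integral_vecs_scale[OF z] y] this, of j m "int p ^ c0"]
        have s: "(of_int (int p ^ c0) *s l = 0 \<longrightarrow> B' dvd m) \<and>
            (of_int (int p ^ c0) *s l \<noteq> 0 \<longrightarrow> (\<exists>i. c / of_nat M \<le> \<bar>(of_int (int p ^ c0) *s l) $ i\<bar>))"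
          unfolding eq .
        show ?thesis
        proof (intro conjI impI)
          assume "l = 0"
          then have "B' dvd m" using s by simp
          moreover have "p ^ (k - c0) dvd m" using pm by (metis int_dvd_int_iff of_nat_power)
          \<comment> \<open>Primes dividing \<open>B'\<close> are at most \<open>Q < p\<close>, so
            the two divisors of \<open>m\<close> multiply.\<close>
          moreover have "coprime B' (p ^ (k - c0))"
          proof -
            have "\<not> p dvd B'" using B'(1)[OF p(1)] pQ(1) by auto
            then show ?thesis using p(1) by (metis coprime_commute coprime_power_left_iff prime_imp_coprime)
          qed
          ultimately show "B dvd m" unfolding B_def by (simp add: divides_mult)
        next
          assume "l \<noteq> 0"
          then have "of_int (int p ^ c0) *s l \<noteq> 0" using p0 by simp
          then obtain i where "c / of_nat M \<le> \<bar>(of_int (int p ^ c0) *s l) $ i\<bar>" using s by blast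
          then have i: "c / of_nat M \<le> of_nat p ^ c0 * \<bar>l $ i\<bar>" by (simp add: abs_mult)
          have "c' / of_nat M \<le> c / of_nat p ^ (c0 + 1) / of_nat M"
            by (rule divide_right_mono[OF c'(3)]) simp
          also have "\<dots> = (c / of_nat M) / of_nat p ^ (c0 + 1)" by simp
          also have "\<dots> \<le> (of_nat p ^ c0 * \<bar>l $ i\<bar>) / of_nat p ^ (c0 + 1)"
            by (rule divide_right_mono[OF i]) simp
          also have "\<dots> = \<bar>l $ i\<bar> / of_nat p" using p0 by simp
          also have "\<dots> \<le> \<bar>l $ i\<bar>" using p0 by (simp add: divide_le_eq mult_le_cancel_left1)
          finally show "\<exists>i. c' / of_nat M \<le> \<bar>l $ i\<bar>" by blast
        qed
      qed
      then show "let l = of_int t *s ((T ^^ (j + m)) v - (T ^^ j) v) - z in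
          (l = 0 \<longrightarrow> B dvd m) \<and> (l \<noteq> 0 \<longrightarrow> (\<exists>i. c' / of_nat M \<le> \<bar>l $ i\<bar>))"
        by (simp only: Let_def l_def act_q)
    qed
  qed
qed

end

section \<open>Reaching the whole space\<close>

context aperiodic_matrix
begin

text \<open>Among pairs of a vector outside \<open>W\<close> and a nonzero polynomial sending it
  into \<open>W\<close>, take one of least degree and clear the denominators of the vector.\<close>

lemma exists_minimal_extension:
  assumes W: "vec.subspace W" "\<And>w. w \<in> W \<Longrightarrow> T w \<in> W" "W \<noteq> UNIV"
  obtains e f where "minimal_extension A W e f"
proof -
  define Z where "Z = {(w, h). w \<notin> W \<and> h \<noteq> 0 \<and> act h w \<in> W}"
  from W(3) obtain w where "w \<notin> W" by blast
  moreover obtain F where "F \<noteq> 0" "act F w = 0" by (rule exists_annihilating_poly)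
  ultimately have "(w, F) \<in> Z" unfolding Z_def using vec.subspace_0[OF W(1)] by simp
  then obtain wf where wf: "wf \<in> Z" "\<And>y. y \<in> Z \<Longrightarrow> degree (snd wf) \<le> degree (snd y)"
    using ex_has_least_nat[of "\<lambda>x. x \<in> Z" "(w, F)" "\<lambda>x. degree (snd x)"] by blast
  obtain w' f where eq: "wf = (w', f)" by (cases wf)
  obtain D :: int where D: "D > 0" "of_int D *s w' \<in> integral_vecs" by (rule vec_common_denominator)
  have "minimal_extension A W (of_int D *s w') f"
  proof
    show "of_int D *s w' \<notin> W"
    proof
      assume "of_int D *s w' \<in> W"
      then have "inverse (of_int D) *s (of_int D *s w') \<in> W" by (rule vec.subspace_scale[OF W(1)])
      then show False using D(1) wf(1) by (simp add: eq Z_def)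
    qed
    show "f \<noteq> 0" "act f (of_int D *s w') \<in> W"
      using wf(1) vec.subspace_scale[OF W(1)] by (auto simp: eq Z_def poly_action_vec_scale)
    fix x and h :: "int poly" assume "x \<notin> W" "h \<noteq> 0" "degree h < degree f"
    then show "act h x \<notin> W" using wf(2)[of "(x, h)"] by (auto simp: eq Z_def)
  qed (use W D in auto)
  then show thesis by (rule that)
qed

text \<open>In place of an explicit flag, take a good subspace of largest dimension; were it proper,
  its extension would be good and strictly larger.\<close>

lemma separated_UNIV: "\<exists>\<delta>\<ge>CARD('n). separated UNIV \<delta>"
proof -
  define good where "good W \<longleftrightarrow> vec.subspace W \<and> (\<forall>w\<in>W. T w \<in> W) \<and> (\<exists>\<delta>\<ge>vec.dim W. separated W \<delta>)" for W
  have "good {0}" using separated_0 by (auto simp: good_def)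
  moreover have "vec.dim W \<le> CARD('n)" for W :: "(rat ^ 'n) set"
    by (rule dim_subset_UNIV_cart_gen)
  ultimately obtain W where W: "good W" "\<And>W'. good W' \<Longrightarrow> vec.dim W' \<le> vec.dim W"
    using ex_has_greatest_nat[of good "{0}" vec.dim "Suc CARD('n)"] by (auto simp: less_Suc_eq_le)
  have "W = UNIV"
  proof (rule ccontr)
    assume "W \<noteq> UNIV"
    then obtain e f where "minimal_extension A W e f"
      using exists_minimal_extension W(1) unfolding good_def by metis
    then interpret minimal_extension A W e f .
    from W(1) obtain \<delta> where \<delta>: "\<delta> \<ge> vec.dim W" "separated W \<delta>" by (auto simp: good_def)
    have "good (ext (degree f))"
      unfolding good_def
    proof (intro conjI exI[of _ "\<delta> + degree f"] ballI)
      show "vec.dim (ext (degree f)) \<le> \<delta> + degree f" using dim_ext_le \<delta>(1) by linarith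
    qed (use subspace_ext invariant_ext separated_ext[OF \<delta>(2)] in auto)
    then have "vec.dim (ext (degree f)) \<le> vec.dim W" by (rule W(2))
    then have "W = ext (degree f)"
      using vec.subspace_dim_equal[OF subspace subspace_ext W_subset_ext] by blast
    then show False using e(1) act_e_mem_ext[of 1] by simp
  qed
  then show ?thesis using W(1) by (auto simp: good_def vec.dim_UNIV card_cart_basis)
qed

end

section \<open>Ergodicity and orbits on the torus\<close>

text \<open>A matrix and not just an iterated map, so that it can be transposed.\<close>

definition mat_pow :: "'a::semiring_1 ^ 'n ^ 'n \<Rightarrow> nat \<Rightarrow> 'a ^ 'n ^ 'n" where
  "mat_pow B s = ((**) B ^^ s) (mat 1)"

lemma mat_pow_simps [simp]: "mat_pow B 0 = mat 1" "mat_pow B (Suc s) = B ** mat_pow B s"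
  by (simp_all add: mat_pow_def)

lemma mat_pow_commute: "B ** mat_pow B s = mat_pow B s ** B"
proof (induction s)
  case (Suc s)
  have "B ** mat_pow B (Suc s) = B ** (mat_pow B s ** B)" by (simp add: Suc)
  then show ?case by (simp add: matrix_mul_assoc)
qed simp

lemma mat_pow_mult_vec: "mat_pow B s *v x = ((*v) B ^^ s) x"
  by (induction s) (simp_all flip: matrix_vector_mul_assoc)

lemma transpose_mat_pow:
  fixes B :: "'a::comm_semiring_1 ^ 'n ^ 'n"
  shows "transpose (mat_pow B s) = mat_pow (transpose B) s"
  by (induction s) (simp_all add: mat_pow_commute matrix_transpose_mul)

text \<open>\<open>B^s - 1\<close> is singular exactly when its transpose is.\<close>

lemma exists_transpose_fixed_vector:
  fixes B :: "'a::field ^ 'n ^ 'n"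
  assumes "((*v) B ^^ s) x = x" "x \<noteq> 0"
  obtains u where "u \<noteq> 0" "((*v) (transpose B) ^^ s) u = u"
proof -
  let ?G = "mat_pow B s - mat 1"
  have "?G *v x = 0" using assms(1) by (simp add: matrix_vector_mult_diff_rdistrib mat_pow_mult_vec)
  then have "\<not> invertible ?G"
    using assms(2) by (metis invertible_def matrix_left_invertible_ker)
  then have "\<not> invertible (transpose ?G)" by (simp add: invertible_det_nz det_transpose)
  then have "\<not> (\<exists>C. C ** transpose ?G = mat 1)" by (simp add: invertible_left_inverse)
  then obtain u where u: "u \<noteq> 0" "transpose ?G *v u = 0"
    unfolding matrix_left_invertible_ker by blast
  have "transpose ?G = mat_pow (transpose B) s - mat 1"
    unfolding transpose_mat_pow[symmetric] by (simp add: transpose_def vec_eq_iff mat_def)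
  then have "((*v) (transpose B) ^^ s) u = u"
    using u(2) by (simp add: matrix_vector_mult_diff_rdistrib mat_pow_mult_vec)
  then show thesis using that u(1) by blast
qed

lemma exists_int_transpose_fixed_vector:
  fixes A :: "int ^ 'n ^ 'n"
  assumes "((*v) (rat_mat A) ^^ s) x = x" "x \<noteq> 0"
  obtains w :: "int ^ 'n" where "w \<noteq> 0" "((*v) (transpose A) ^^ s) w = w"
proof -
  define r :: "int ^ 'n \<Rightarrow> rat ^ 'n" where "r w = (\<chi> i. of_int (w $ i))" for w
  obtain u where u: "u \<noteq> 0" "((*v) (transpose (rat_mat A)) ^^ s) u = u"
    by (rule exists_transpose_fixed_vector[OF assms])
  obtain D :: int where D: "D > 0" "of_int D *s u \<in> integral_vecs" by (rule vec_common_denominator)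
  define w where "w = (\<chi> i. \<lfloor>(of_int D *s u) $ i\<rfloor>)"
  have rw: "r w = of_int D *s u"
    using D(2) by (simp add: r_def w_def integral_vecs_def vec_eq_iff)
  have T: "transpose (rat_mat A) *v r y = r (transpose A *v y)" for y
    by (simp add: r_def rat_mat_def transpose_def matrix_vector_mult_def vec_eq_iff)
  have "((*v) (transpose (rat_mat A)) ^^ i) (r y) = r (((*v) (transpose A) ^^ i) y)" for i y
    by (induction i) (simp_all only: funpow.simps id_apply o_apply T)
  then have "r (((*v) (transpose A) ^^ s) w) = r w"
    using u(2) by (metis rw funpow_matrix_scale)
  then have "((*v) (transpose A) ^^ s) w = w" by (simp add: r_def vec_eq_iff)
  moreover have "r w \<noteq> 0" using rw u(1) D(1) by simp
  then have "w \<noteq> 0" by (auto simp: r_def vec_eq_iff)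
  ultimately show thesis by (rule that[rotated])
qed

lemma cos_2pi_shift: "k \<in> \<int> \<Longrightarrow> cos (2 * pi * (y + k)) = cos (2 * pi * y)"
proof -
  assume "k \<in> \<int>"
  then obtain n where "k = of_int n" by (elim Ints_cases)
  then show ?thesis using cos_int_2pin[of n] sin_int_2pin[of n] by (simp add: distrib_left cos_add)
qed

lemma tfrac_diff_int: "tfrac x - x \<in> int_vecs"
  by (simp add: tfrac_def int_vecs_def frac_def)

lemma tfrac_in_unit_cube: "tfrac x \<in> unit_cube"
  by (simp add: tfrac_def unit_cube_def frac_lt_1)

lemma emeasure_open_pos:
  fixes S :: "(real ^ 'n) set"
  assumes "open S" "S \<noteq> {}"
  shows "emeasure lborel S > 0"
proof -
  have "\<not> negligible S" using open_not_negligible assms by blast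
  then have "emeasure lebesgue S \<noteq> 0" using assms(1) by (subst (asm) negligible_iff_emeasure0) auto
  then show ?thesis using assms(1) by (simp add: zero_less_iff_neq_zero)
qed

text \<open>
  An integral row vector \<open>u\<close> with \<open>u A^s = u\<close> yields finitely many characters permuted by \<open>A\<close>; the set
  where all their real parts are positive is invariant, but neither null nor conull.
\<close>

lemma ergodic_imp_aperiodic:
  fixes A :: "int ^ 'n ^ 'n"
  assumes erg: "ergodic_torus A" and s: "s > 0" and fix_x: "((*v) (rat_mat A) ^^ s) x = x"
  shows "x = 0"
proof (rule ccontr)
  assume "x \<noteq> 0"
  then obtain u :: "int ^ 'n" where u: "u \<noteq> 0" "((*v) (transpose A) ^^ s) u = u"
    using exists_int_transpose_fixed_vector[OF fix_x] by blast
  \<comment> \<open>\<open>w t\<close> is the frequency of a character composed with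
    \<open>A^t\<close> and \<open>\<psi> t\<close> its real part, so composing with
    \<open>tmap A\<close> shifts \<open>t\<close>.\<close>
  define w where "w t = ((*v) (transpose A) ^^ t) u" for t
  define \<psi> where "\<psi> t y = cos (2 * pi * (\<Sum>j\<in>UNIV. of_int (w t $ j) * y $ j))" for t and y :: "real ^ 'n"
  have w_Suc: "w (Suc t) = transpose A *v w t" for t by (simp add: w_def)
  have w_period: "w (t + s) = w t" for t using u(2) by (simp add: w_def funpow_add)
  have w_mod: "w t = w (t mod s)" for t
  proof (induction t rule: less_induct)
    case (less t)
    show ?case
    proof (cases "t < s")
      case False
      then have "w t = w (t - s)" using w_period[of "t - s"] by simp
      then show ?thesis using less[of "t - s"] False s by (simp add: le_mod_geq)
    qed simp
  qed
  have \<psi>_tmap: "\<psi> t (tmap A y) = \<psi> (Suc t) y" for t y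
  proof -
    let ?z = "tmap A y - real_mat A *v y"
    have z: "?z \<in> int_vecs" unfolding tmap_def by (rule tfrac_diff_int)
    have "(\<Sum>j\<in>UNIV. of_int (w t $ j) * tmap A y $ j) =
        (\<Sum>j\<in>UNIV. of_int (w t $ j) * (real_mat A *v y) $ j) + (\<Sum>j\<in>UNIV. of_int (w t $ j) * ?z $ j)"
      by (simp add: sum.distrib[symmetric] algebra_simps)
    moreover have "(\<Sum>j\<in>UNIV. of_int (w t $ j) * ?z $ j) \<in> \<int>"
      using z by (intro Ints_sum Ints_mult) (auto simp: int_vecs_def)
    moreover have "(\<Sum>j\<in>UNIV. of_int (w t $ j) * (real_mat A *v y) $ j) =
        (\<Sum>j\<in>UNIV. of_int (w (Suc t) $ j) * y $ j)"
      unfolding w_Suc matrix_vector_mult_def real_mat_def transpose_def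
      by (simp add: sum_distrib_left sum_distrib_right mult_ac) (rule sum.swap)
    ultimately show ?thesis by (simp add: \<psi>_def cos_2pi_shift)
  qed
  \<comment> \<open>Periodicity extends these conditions to all \<open>t\<close>, while their finite
    number makes \<open>F\<close> open.\<close>
  define F where "F = {y. \<forall>t<s. \<psi> t y > 0}"
  have F: "y \<in> F \<longleftrightarrow> (\<forall>t. \<psi> t y > 0)" for y
  proof -
    have "\<psi> t y = \<psi> (t mod s) y" for t using w_mod[of t] by (simp add: \<psi>_def)
    then show ?thesis unfolding F_def using mod_less_divisor[OF s] by force
  qed
  have cont: "continuous_on UNIV (\<psi> t)" for t
    unfolding \<psi>_def by (intro continuous_intros)
  have F_eq: "F = (\<Inter>t\<in>{..<s}. {y. 0 < \<psi> t y})" by (auto simp: F_def)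
  have "open {y. 0 < \<psi> t y}" for t
    by (intro open_Collect_less cont continuous_intros)
  then have open_F: "open F"
    unfolding F_eq by (intro open_INT) auto
  have "open {y. \<psi> 0 y < 0}" by (intro open_Collect_less cont continuous_intros)
  define E where "E = unit_cube \<inter> F"
  let ?one = "(\<chi> i. 1) :: real ^ 'n"
  have E_sets: "E \<in> sets lborel"
  proof -
    have "unit_cube = (\<Inter>i. {y :: real ^ 'n. 0 \<le> y $ i}) \<inter> (\<Inter>i. {y. y $ i < 1})"
      by (auto simp: unit_cube_def)
    moreover have "closed (\<Inter>i. {y :: real ^ 'n. 0 \<le> y $ i})"
      by (intro closed_INT ballI closed_Collect_le continuous_intros)
    moreover have "open {y :: real ^ 'n. y $ i < 1}" for i
      by (intro open_Collect_less continuous_intros)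
    then have "open (\<Inter>i. {y :: real ^ 'n. y $ i < 1})" by (intro open_INT) auto
    ultimately have "(unit_cube :: (real ^ 'n) set) \<in> sets borel"
      by (metis borel_closed borel_open sets.Int)
    then show ?thesis unfolding E_def using open_F by auto
  qed
  have inv: "{y \<in> unit_cube. tmap A y \<in> E} = E"
  proof -
    have "(\<forall>t. \<psi> (Suc t) y > 0) \<longleftrightarrow> (\<forall>t. \<psi> t y > 0)" for y
    proof
      assume *: "\<forall>t. \<psi> (Suc t) y > 0"
      \<comment> \<open>The shift loses the condition at index 0; it is recovered at index
        \<open>s\<close>.\<close>
      have "\<psi> 0 y = \<psi> (Suc (s - 1)) y" using w_period[of 0] s by (simp add: \<psi>_def)
      then show "\<forall>t. \<psi> t y > 0" using * by (metis not0_implies_Suc)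
    qed auto
    moreover have "tmap A y \<in> unit_cube" for y unfolding tmap_def by (rule tfrac_in_unit_cube)
    ultimately show ?thesis by (auto simp: E_def F \<psi>_tmap)
  qed
  have box_sub: "box 0 ?one \<subseteq> unit_cube" "unit_cube \<subseteq> cbox 0 ?one"
    by (auto simp: unit_cube_def mem_box_cart less_imp_le)
  \<comment> \<open>The points used below can lie on the boundary of the cube; open sets around them
    still meet its interior.\<close>
  have meets: "S \<inter> box 0 ?one \<noteq> {}" if "open S" "y \<in> S" "y \<in> cbox 0 ?one" for S y
  proof -
    have "(\<chi> i. 1/2) \<in> box 0 ?one" by (simp add: mem_box_cart)
    then have "closure (box 0 ?one) = cbox 0 ?one" by (intro closure_box) auto
    then show ?thesis using that open_Int_closure_eq_empty[OF that(1), of "box 0 ?one"] by blast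
  qed
  have "emeasure lborel E > 0"
  proof -
    have "0 \<in> F" by (simp add: F \<psi>_def)
    then have "F \<inter> box 0 ?one \<noteq> {}" by (intro meets open_F) (auto simp: mem_box_cart)
    then have "emeasure lborel (F \<inter> box 0 ?one) > 0" by (intro emeasure_open_pos open_Int open_F open_box)
    also have "\<dots> \<le> emeasure lborel E" using box_sub by (intro emeasure_mono E_sets) (auto simp: E_def)
    finally show ?thesis .
  qed
  moreover have "emeasure lborel E \<noteq> 1"
  proof
    assume E1: "emeasure lborel E = 1"
    obtain i where i: "u $ i \<noteq> 0" using u(1) by (auto simp: vec_eq_iff)
    let ?G = "{y. \<psi> 0 y < 0} \<inter> box 0 ?one"
    \<comment> \<open>The pairing with \<open>u\<close> is 1/2 or -1/2, where the cosine is
      -1.\<close>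
    let ?y = "axis i (1 / (2 * \<bar>of_int (u $ i)\<bar>)) :: real ^ 'n"
    have "(\<Sum>j\<in>UNIV. of_int (w 0 $ j) * ?y $ j) = of_int (u $ i) * (1 / (2 * \<bar>of_int (u $ i)\<bar>))"
      by (simp add: w_def axis_def if_distrib[of "\<lambda>z. _ * z"] cong: if_cong)
    also have "\<dots> = (if u $ i > 0 then 1 / 2 else - 1 / 2)" using i by (auto simp: field_simps)
    finally have "\<psi> 0 ?y = -1" by (simp add: \<psi>_def)
    moreover have "1 / (2 * \<bar>of_int (u $ i)\<bar>) \<le> (1 :: real)"
      using i by (simp add: divide_le_eq)
    then have "?y \<in> cbox 0 ?one" by (auto simp: mem_box_cart axis_def)
    ultimately have "?G \<noteq> {}"
      using \<open>open {y. \<psi> 0 y < 0}\<close> by (intro meets[of _ ?y]) auto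
    then have "emeasure lborel ?G > 0"
      using \<open>open {y. \<psi> 0 y < 0}\<close> by (intro emeasure_open_pos open_Int open_box)
    \<comment> \<open>\<open>?G\<close> takes positive measure out of a cube of measure 1, so the
      disjoint \<open>E\<close> cannot have full measure.\<close>
    moreover have "E \<inter> ?G = {}" by (auto simp: E_def F) (meson not_less_iff_gr_or_eq)
    then have "emeasure lborel (E \<union> ?G) = emeasure lborel E + emeasure lborel ?G"
      using E_sets \<open>open {y. \<psi> 0 y < 0}\<close> by (intro plus_emeasure[symmetric]) auto
    moreover have "emeasure lborel (E \<union> ?G) \<le> emeasure lborel (cbox 0 ?one)"
      using box_sub by (intro emeasure_mono) (auto simp: E_def)
    moreover have "emeasure lborel (cbox 0 ?one) = 1"
    proof -
      have "?one \<bullet> b = 1" if "b \<in> Basis" for b :: "real ^ 'n"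
        using that by (auto simp: Basis_vec_def inner_axis)
      then show ?thesis by (subst emeasure_lborel_cbox) (auto simp: prod.neutral)
    qed
    ultimately have "1 + emeasure lborel ?G \<le> 1 + 0" "emeasure lborel ?G > 0" using E1 by simp_all
    then show False unfolding ennreal_add_left_cancel_le by simp
  qed
  moreover have "E \<subseteq> unit_cube" by (auto simp: E_def)
  ultimately show False using erg E_sets inv unfolding ergodic_torus_def by force
qed

section \<open>Rational points of the torus and their orbits\<close>

definition rat_vec :: "rat ^ 'n \<Rightarrow> real ^ 'n" where
  "rat_vec x = (\<chi> i. of_rat (x $ i))"

lemma rat_vec_diff: "rat_vec (x - y) = rat_vec x - rat_vec y"
  by (simp add: rat_vec_def vec_eq_iff of_rat_diff)

lemma real_mat_rat_vec: "real_mat A *v rat_vec x = rat_vec (rat_mat A *v x)"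
  by (simp add: rat_vec_def real_mat_def rat_mat_def matrix_vector_mult_def vec_eq_iff of_rat_sum of_rat_mult)

lemma int_vecs_rat_vecE:
  assumes "z \<in> int_vecs"
  obtains y where "y \<in> integral_vecs" "z = rat_vec y"
proof
  show "(\<chi> i. of_int \<lfloor>z $ i\<rfloor>) \<in> integral_vecs" by (simp add: integral_vecs_def)
  show "z = rat_vec (\<chi> i. of_int \<lfloor>z $ i\<rfloor>)"
    using assms by (simp add: rat_vec_def int_vecs_def vec_eq_iff)
qed

lemma rat_vec_int_iff: "rat_vec x \<in> int_vecs \<longleftrightarrow> x \<in> integral_vecs"
proof
  assume "rat_vec x \<in> int_vecs"
  then obtain y where "y \<in> integral_vecs" "rat_vec x = rat_vec y" by (rule int_vecs_rat_vecE)
  then show "x \<in> integral_vecs" by (metis (mono_tags, lifting) of_rat_eq_iff rat_vec_def vec_eq_iff vec_lambda_beta)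
next
  assume "x \<in> integral_vecs"
  then show "rat_vec x \<in> int_vecs"
    by (auto simp: integral_vecs_def int_vecs_def rat_vec_def elim!: Ints_cases) (metis Ints_cases Ints_of_int of_rat_of_int_eq)
qed

lemma tfrac_eq_iff: "tfrac x = tfrac y \<longleftrightarrow> x - y \<in> int_vecs"
proof -
  have "frac a = frac b \<longleftrightarrow> a - b \<in> \<int>" for a b :: real
  proof
    assume "frac a = frac b"
    then have "a - b = of_int (\<lfloor>a\<rfloor> - \<lfloor>b\<rfloor>)" by (simp add: frac_def)
    then show "a - b \<in> \<int>" by (metis Ints_of_int)
  next
    assume "a - b \<in> \<int>"
    then obtain n where "a = b + of_int n" by (metis Ints_cases add.commute diff_add_cancel)
    then show "frac a = frac b" by (simp add: frac_def)
  qed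
  then show ?thesis by (simp add: tfrac_def int_vecs_def vec_eq_iff)
qed

lemma int_vecs_real_mat: "x \<in> int_vecs \<Longrightarrow> real_mat A *v x \<in> int_vecs"
  by (auto simp: int_vecs_def real_mat_def matrix_vector_mult_def)

lemma tmap_tfrac: "tmap A (tfrac x) = tfrac (real_mat A *v x)"
  unfolding tmap_def tfrac_eq_iff
  using int_vecs_real_mat[OF tfrac_diff_int] by (simp add: matrix_vector_mult_diff_distrib)

lemma tmap_funpow_rat_vec:
  "(tmap A ^^ i) (tfrac (rat_vec x)) = tfrac (rat_vec (((*v) (rat_mat A) ^^ i) x))"
  by (induction i) (simp_all add: tmap_tfrac real_mat_rat_vec)

text \<open>By Cramer's rule \<open>det A * x\<close> is integral, and so is \<open>N * x\<close>;
  coprimality leaves no denominator. Hence \<open>A\<close> is injective on \<open>N\<close>-torsion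
  points.\<close>

lemma integral_if_rat_mat_integral:
  assumes "rat_mat A *v x \<in> integral_vecs" "of_nat N *s x \<in> integral_vecs" "coprime (int N) (det A)"
  shows "x \<in> integral_vecs"
proof -
  have "x $ k \<in> \<int>" for k
  proof -
    have "det ((\<chi> i j. if j = k then (rat_mat A *v x) $ i else rat_mat A $ i $ j) :: rat ^ 'a ^ 'a) \<in> \<int>"
      using assms(1) unfolding det_def
      by (intro Ints_sum Ints_mult Ints_prod) (auto simp: integral_vecs_def rat_mat_def)
    then have 1: "x $ k * of_int (det A) \<in> \<int>" by (simp only: cramer_lemma det_rat_mat)
    have 2: "x $ k * of_nat N \<in> \<int>" using assms(2) by (simp add: integral_vecs_def mult.commute)
    obtain a b where ab: "a * int N + b * det A = 1"
      using assms(3) by (metis bezout_int coprime_imp_gcd_eq_1)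
    have "x $ k = of_int a * (x $ k * of_nat N) + of_int b * (x $ k * of_int (det A))"
      using arg_cong[OF ab, of "\<lambda>n. x $ k * of_int n"] by (simp add: algebra_simps)
    then show ?thesis using 1 2 by (metis Ints_add Ints_mult Ints_of_int)
  qed
  then show ?thesis by (simp add: integral_vecs_def)
qed

lemma finite_torsion_points:
  fixes N :: nat
  assumes "N > 0"
  shows "finite {x :: real ^ 'n. x \<in> unit_cube \<and> of_nat N *\<^sub>R x \<in> int_vecs}"
proof -
  let ?S = "(\<lambda>b. of_int b / of_nat N) ` {0..<int N} :: real set"
  have "{x :: real ^ 'n. x \<in> unit_cube \<and> of_nat N *\<^sub>R x \<in> int_vecs} \<subseteq> vec_lambda ` (PiE UNIV (\<lambda>_. ?S))"
  proof
    fix x :: "real ^ 'n" assume "x \<in> {x. x \<in> unit_cube \<and> of_nat N *\<^sub>R x \<in> int_vecs}"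
    then have x: "\<And>i. 0 \<le> x $ i" "\<And>i. x $ i < 1" "\<And>i. of_nat N * x $ i \<in> \<int>"
      by (auto simp: unit_cube_def int_vecs_def)
    have "x $ i \<in> ?S" for i
    proof -
      obtain b where b: "of_nat N * x $ i = of_int b" using x(3) by (metis Ints_cases)
      have "0 \<le> of_nat N * x $ i" "of_nat N * x $ i < of_nat N" using x assms by auto
      then have "b \<in> {0..<int N}" unfolding b by auto
      moreover have "x $ i = of_int b / of_nat N" using b assms by (simp add: field_simps)
      ultimately show ?thesis by blast
    qed
    then have "($) x \<in> PiE UNIV (\<lambda>_. ?S)" by auto
    then show "x \<in> vec_lambda ` (PiE UNIV (\<lambda>_. ?S))"
      by (intro image_eqI[where f = vec_lambda and x = "($) x"]) simp_all
  qed
  moreover have "finite (PiE (UNIV :: 'n set) (\<lambda>_. ?S))" by (intro finite_PiE) auto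
  ultimately show ?thesis using finite_subset by blast
qed

text \<open>The orbit stays among the finitely many \<open>N\<close>-torsion points, so two iterates
  coincide; injectivity on these points removes the preperiod.\<close>

lemma (in aperiodic_matrix) torsion_orbit:
  assumes N: "N > 0" "coprime (int N) (det A)" "of_nat N *s v \<in> integral_vecs"
  defines "Orb \<equiv> {(tmap A ^^ i) (tfrac (rat_vec v)) | i. True}"
  shows "periodic_orbit A Orb" "finite Orb"
proof -
  have Nv: "of_nat N *s (T ^^ i) v \<in> integral_vecs" for i
  proof (induction i)
    case (Suc i)
    then have "T (of_nat N *s (T ^^ i) v) \<in> integral_vecs" by (rule integral_vecs_rat_mat)
    then show ?case by (simp add: vec.scale)
  qed (use N in simp)
  let ?x = "\<lambda>i. (tmap A ^^ i) (tfrac (rat_vec v))"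
  have "?x i \<in> {x. x \<in> unit_cube \<and> of_nat N *\<^sub>R x \<in> int_vecs}" for i
  proof -
    let ?y = "rat_vec ((T ^^ i) v)"
    have "of_nat N *\<^sub>R (tfrac ?y - ?y) \<in> int_vecs"
      using tfrac_diff_int[of ?y] by (auto simp: int_vecs_def)
    moreover have "of_nat N *\<^sub>R ?y = rat_vec (of_nat N *s (T ^^ i) v)"
      by (simp add: rat_vec_def vec_eq_iff of_rat_mult)
    then have "of_nat N *\<^sub>R ?y \<in> int_vecs" using Nv rat_vec_int_iff by metis
    moreover have "of_nat N *\<^sub>R tfrac ?y = of_nat N *\<^sub>R (tfrac ?y - ?y) + of_nat N *\<^sub>R ?y"
      by (simp add: algebra_simps)
    ultimately have "of_nat N *\<^sub>R tfrac ?y \<in> int_vecs" by (auto simp: int_vecs_def)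
    then show ?thesis by (simp add: tmap_funpow_rat_vec tfrac_in_unit_cube)
  qed
  then have "range ?x \<subseteq> {x. x \<in> unit_cube \<and> of_nat N *\<^sub>R x \<in> int_vecs}" by blast
  then have fin: "finite (range ?x)" using finite_torsion_points[OF N(1)] finite_subset by blast
  moreover have "Orb = range ?x" by (auto simp: Orb_def)
  ultimately show "finite Orb" by simp
  have "\<not> inj ?x" using fin finite_imageD infinite_UNIV_nat by blast
  then obtain i j where ij: "i < j" "?x i = ?x j" unfolding inj_def by (metis linorder_neqE_nat)
  have *: "(T ^^ l) ((T ^^ m) v - v) \<in> integral_vecs \<Longrightarrow> (T ^^ m) v - v \<in> integral_vecs" for l m
  proof (induction l)
    case (Suc l)
    have "of_nat N *s (T ^^ l) ((T ^^ m) v - v) = of_nat N *s (T ^^ (l + m)) v - of_nat N *s (T ^^ l) v"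
      by (simp add: funpow_matrix_diff funpow_add vec.scale_right_diff_distrib)
    then have "of_nat N *s (T ^^ l) ((T ^^ m) v - v) \<in> integral_vecs"
      using Nv integral_vecs_diff by metis
    moreover have "T ((T ^^ l) ((T ^^ m) v - v)) \<in> integral_vecs" using Suc.prems by simp
    ultimately have "(T ^^ l) ((T ^^ m) v - v) \<in> integral_vecs"
      using integral_if_rat_mat_integral[OF _ _ N(2)] by blast
    then show ?case by (rule Suc.IH)
  qed simp
  have "(T ^^ i) v - (T ^^ j) v \<in> integral_vecs"
    using ij(2) unfolding tmap_funpow_rat_vec tfrac_eq_iff by (metis rat_vec_diff rat_vec_int_iff)
  then have "of_int (-1) *s ((T ^^ i) v - (T ^^ j) v) \<in> integral_vecs" by (rule integral_vecs_scale)
  then have "(T ^^ i) ((T ^^ (j - i)) v - v) \<in> integral_vecs"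
    using ij(1) funpow_add[of i "j - i" T] by (simp add: funpow_matrix_diff)
  then have "(T ^^ (j - i)) v - v \<in> integral_vecs" by (rule *)
  then have "?x (j - i) = tfrac (rat_vec v)"
    unfolding tmap_funpow_rat_vec tfrac_eq_iff by (metis rat_vec_diff rat_vec_int_iff)
  moreover have "j - i \<ge> 1" using ij(1) by simp
  ultimately show "periodic_orbit A Orb"
    unfolding periodic_orbit_def Orb_def using tfrac_in_unit_cube by blast
qed

text \<open>Coinciding points among the first \<open>B\<close> would make \<open>B\<close> divide a
  positive number below \<open>B\<close>. A lift of a difference of distinct orbit points is
  \<open>T^i v - T^j v\<close> up to an integral vector, hence nonzero and of size at least
  \<open>\<epsilon>\<close>. With \<open>B \<ge> 2\<close> the minimum in \<open>orbit_dist\<close>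
  is over a nonempty set.\<close>

lemma (in aperiodic_matrix) separated_orbit:
  assumes sep: "\<And>j m z. z \<in> integral_vecs \<Longrightarrow>
      ((T ^^ (j + m)) v - (T ^^ j) v - z = 0 \<longrightarrow> B dvd m) \<and>
      ((T ^^ (j + m)) v - (T ^^ j) v - z \<noteq> 0 \<longrightarrow> (\<exists>i. \<epsilon> \<le> \<bar>((T ^^ (j + m)) v - (T ^^ j) v - z) $ i\<bar>))"
    and B: "B \<ge> 2"
  defines "Orb \<equiv> {(tmap A ^^ i) (tfrac (rat_vec v)) | i. True}"
  assumes fin: "finite Orb"
  shows "period Orb \<ge> B" "orbit_dist Orb \<ge> of_rat \<epsilon>"
proof -
  let ?x = "\<lambda>i. (tmap A ^^ i) (tfrac (rat_vec v))"
  have "inj_on ?x {..<B}"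
  proof (rule linorder_inj_onI)
    fix i j assume ij: "i < j" "i \<in> {..<B}" "j \<in> {..<B}"
    show "?x i \<noteq> ?x j"
    proof
      assume "?x i = ?x j"
      then have "(T ^^ j) v - (T ^^ i) v \<in> integral_vecs"
        unfolding tmap_funpow_rat_vec by (metis rat_vec_diff rat_vec_int_iff tfrac_eq_iff)
      from sep[OF this, of i "j - i"] ij(1) have "B dvd j - i" by simp
      then show False using ij dvd_imp_le[of B "j - i"] by auto
    qed
  qed auto
  then have "B = card (?x ` {..<B})" by (simp add: card_image)
  also have "\<dots> \<le> card Orb" by (intro card_mono fin) (auto simp: Orb_def)
  finally show per: "period Orb \<ge> B" by (simp add: period_def)
  have dist: "of_rat \<epsilon> \<le> norm (?x i - ?x j - z)" if "?x i \<noteq> ?x j" "z \<in> int_vecs" for i j z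
  proof -
    let ?a = "(T ^^ i) v" and ?b = "(T ^^ j) v"
    have "(tfrac (rat_vec ?b) - rat_vec ?b) - (tfrac (rat_vec ?a) - rat_vec ?a) + z \<in> int_vecs"
      using that(2) tfrac_diff_int[of "rat_vec ?a"] tfrac_diff_int[of "rat_vec ?b"] by (simp add: int_vecs_def)
    then obtain y where y: "y \<in> integral_vecs"
      "(tfrac (rat_vec ?b) - rat_vec ?b) - (tfrac (rat_vec ?a) - rat_vec ?a) + z = rat_vec y"
      by (rule int_vecs_rat_vecE)
    have eq: "?x i - ?x j - z = rat_vec (?a - ?b - y)"
      unfolding tmap_funpow_rat_vec rat_vec_diff y(2)[symmetric] by simp
    have "?a - ?b \<notin> integral_vecs"
      using that(1) unfolding tmap_funpow_rat_vec tfrac_eq_iff by (metis rat_vec_diff rat_vec_int_iff)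
    then have ne: "?a - ?b - y \<noteq> 0" using y(1) by auto
    have "\<exists>l. \<epsilon> \<le> \<bar>(?a - ?b - y) $ l\<bar>"
    proof (cases "j \<le> i")
      case True
      then show ?thesis using sep[OF y(1), of j "i - j"] ne by simp
    next
      \<comment> \<open>The separation covers forward differences; the other order follows by a
        change of sign.\<close>
      case False
      have y': "of_int (-1) *s y \<in> integral_vecs" by (rule integral_vecs_scale[OF y(1)])
      have "?b - ?a - of_int (-1) *s y = - (?a - ?b - y)" by simp
      moreover have "i + (j - i) = j" using False by simp
      ultimately have "- (?a - ?b - y) \<noteq> 0 \<longrightarrow> (\<exists>l. \<epsilon> \<le> \<bar>(- (?a - ?b - y)) $ l\<bar>)"
        using sep[OF y', of i "j - i"] by metis
      then show ?thesis using ne by (metis abs_minus_cancel neg_equal_0_iff_equal vector_uminus_component)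
    qed
    then obtain l where "\<epsilon> \<le> \<bar>(?a - ?b - y) $ l\<bar>" by blast
    then have "of_rat \<epsilon> \<le> (of_rat \<bar>(?a - ?b - y) $ l\<bar> :: real)" by (simp only: of_rat_less_eq)
    also have "\<dots> = \<bar>rat_vec (?a - ?b - y) $ l\<bar>"
      unfolding rat_vec_def by (simp only: vec_lambda_beta abs_of_rat)
    also have "\<dots> \<le> norm (?x i - ?x j - z)" unfolding eq by (rule component_le_norm_cart)
    finally show ?thesis .
  qed
  let ?D = "{tdist x y | x y. x \<in> Orb \<and> y \<in> Orb \<and> x \<noteq> y}"
  have "?D = (\<lambda>(x, y). tdist x y) ` ({(x, y). x \<noteq> y} \<inter> Orb \<times> Orb)" by auto
  then have finD: "finite ?D" using fin by simp
  have "\<not> (\<exists>x. Orb \<subseteq> {x})"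
  proof
    assume "\<exists>x. Orb \<subseteq> {x}"
    then have "card Orb \<le> 1" by (metis card_mono finite.emptyI finite_insert is_singletonI is_singleton_altdef)
    then show False using per B by (simp add: period_def)
  qed
  then obtain y where "y \<in> Orb" "y \<noteq> ?x 0" by blast
  moreover have "?x 0 \<in> Orb" unfolding Orb_def by blast
  ultimately have "?D \<noteq> {}" by blast
  with finD have "orbit_dist Orb \<in> ?D" unfolding orbit_dist_def by (rule Min_in)
  then obtain i j where ij: "orbit_dist Orb = tdist (?x i) (?x j)" "?x i \<noteq> ?x j" by (auto simp: Orb_def)
  have "of_rat \<epsilon> \<le> tdist (?x i) (?x j)"
    unfolding tdist_def
  proof (rule cInf_greatest)
    have "0 \<in> int_vecs" by (simp add: int_vecs_def)
    then show "{norm (?x i - ?x j - m) | m. m \<in> int_vecs} \<noteq> {}" by blast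
  qed (use dist[OF ij(2)] in auto)
  then show "orbit_dist Orb \<ge> of_rat \<epsilon>" using ij(1) by simp
qed

theorem theorem1p1:
  fixes A :: "int ^ 'n ^ 'n"
  assumes "det A \<noteq> 0"
    and "ergodic_torus A"
  shows "\<exists>C > 0. \<exists>Orb :: nat \<Rightarrow> (real ^ 'n) set.
           (\<forall>k. periodic_orbit A (Orb k) \<and>
                orbit_dist (Orb k) ^ CARD('n) * real (period (Orb k)) \<ge> C) \<and>
           filterlim (\<lambda>k. period (Orb k)) at_top sequentially"
proof -
  interpret aperiodic_matrix A
    using assms ergodic_imp_aperiodic by unfold_locales blast+
  obtain \<delta> where \<delta>: "\<delta> \<ge> CARD('n)" "separated UNIV \<delta>" using separated_UNIV by blast
  then obtain Q c where c: "c > 0" and sep: "\<And>M. M \<ge> 1 \<Longrightarrow> \<exists>v\<in>UNIV. \<exists>N B :: nat.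
     N > 0 \<and> coprime (int N) (det A) \<and> of_nat N *s v \<in> integral_vecs \<and>
     (\<forall>q. prime q \<longrightarrow> q dvd B \<longrightarrow> q \<le> Q) \<and> c * of_nat M ^ \<delta> \<le> (of_nat B :: rat) \<and>
     (\<forall>t j m. \<forall>z\<in>integral_vecs. coprime t (fact Q :: int) \<longrightarrow>
        (let l = of_int t *s ((T ^^ (j + m)) v - (T ^^ j) v) - z in
          (l = 0 \<longrightarrow> B dvd m) \<and> (l \<noteq> 0 \<longrightarrow> (\<exists>i. c / of_nat M \<le> \<bar>l $ i\<bar>))))"
    unfolding separated_def by blast
  define r :: real where "r = of_rat c"
  have r: "r > 0" using c by (simp add: r_def)
  have "\<exists>Orb. periodic_orbit A Orb \<and> orbit_dist Orb ^ CARD('n) * real (period Orb) \<ge> r ^ CARD('n) * r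
      \<and> period Orb \<ge> k" for k
  proof -
    \<comment> \<open>\<open>r * M \<ge> k + 2\<close> forces \<open>B \<ge> k + 2\<close>, giving
      both \<open>B \<ge> 2\<close> and unbounded periods.\<close>
    obtain M0 :: nat where M0: "real (k + 2) / r \<le> real M0" using real_arch_simple by blast
    define M where "M = M0 + 1"
    have M: "M \<ge> 1" by (simp add: M_def)
    have rM: "real (k + 2) \<le> r * real M"
      using M0 r by (simp add: M_def pos_divide_le_eq algebra_simps)
    obtain v N B where N: "N > 0" "coprime (int N) (det A)" "of_nat N *s v \<in> integral_vecs"
      and B: "c * of_nat M ^ \<delta> \<le> (of_nat B :: rat)"
      and sep': "\<forall>t j m. \<forall>z\<in>integral_vecs. coprime t (fact Q :: int) \<longrightarrow>
        (let l = of_int t *s ((T ^^ (j + m)) v - (T ^^ j) v) - z in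
          (l = 0 \<longrightarrow> B dvd m) \<and> (l \<noteq> 0 \<longrightarrow> (\<exists>i. c / of_nat M \<le> \<bar>l $ i\<bar>)))"
      using sep[OF M] by blast
    have "of_rat (c * of_nat M ^ \<delta>) \<le> (of_rat (of_nat B) :: real)" using B by (simp only: of_rat_less_eq)
    then have "r * real M ^ \<delta> \<le> real B" by (simp add: r_def of_rat_mult of_rat_power)
    moreover have "r * real M ^ CARD('n) \<le> r * real M ^ \<delta>"
      using M r \<delta>(1) by (intro mult_left_mono power_increasing) auto
    ultimately have rB: "r * real M ^ CARD('n) \<le> real B" by linarith
    have "r * real M ^ 1 \<le> r * real M ^ CARD('n)"
      using M r by (intro mult_left_mono power_increasing) (auto simp: Suc_leI)
    then have kB: "k + 2 \<le> B" using rM rB by simp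
    define Orb where "Orb = {(tmap A ^^ i) (tfrac (rat_vec v)) | i. True}"
    have per: "periodic_orbit A Orb" and fin: "finite Orb"
      unfolding Orb_def using torsion_orbit[OF N] by blast+
    have s1: "((T ^^ (j + m)) v - (T ^^ j) v - z = 0 \<longrightarrow> B dvd m) \<and>
      ((T ^^ (j + m)) v - (T ^^ j) v - z \<noteq> 0 \<longrightarrow>
        (\<exists>i. c / of_nat M \<le> \<bar>((T ^^ (j + m)) v - (T ^^ j) v - z) $ i\<bar>))"
      if "z \<in> integral_vecs" for j m z
      using sep'[rule_format, OF that, of 1 j m] by (simp add: Let_def)
    have "2 \<le> B" using kB by simp
    from separated_orbit[OF s1 this] fin
    have TB: "period Orb \<ge> B" and d: "orbit_dist Orb \<ge> of_rat (c / of_nat M)"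
      unfolding Orb_def by blast+
    \<comment> \<open>The distance is at least \<open>r / M\<close> and the period at least
      \<open>r * M^n\<close>, so the powers of \<open>M\<close> cancel.\<close>
    have "r ^ CARD('n) * r = (r / real M) ^ CARD('n) * (r * real M ^ CARD('n))"
      using M by (simp add: power_divide)
    also have "\<dots> \<le> orbit_dist Orb ^ CARD('n) * real (period Orb)"
    proof (intro mult_mono power_mono)
      show d': "r / real M \<le> orbit_dist Orb" using d by (simp add: r_def of_rat_divide)
      show "r * real M ^ CARD('n) \<le> real (period Orb)" using rB TB by linarith
      have "0 \<le> r / real M" using r by simp
      then have "0 \<le> orbit_dist Orb" using d' by (rule order_trans)
      then show "0 \<le> orbit_dist Orb ^ CARD('n)" by simp
    qed (use r in auto)
    finally show ?thesis using per TB kB by (intro exI[of _ Orb]) simp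
  qed
  then obtain Orb where Orb: "\<And>k. periodic_orbit A (Orb k)"
    "\<And>k. orbit_dist (Orb k) ^ CARD('n) * real (period (Orb k)) \<ge> r ^ CARD('n) * r"
    "\<And>k. period (Orb k) \<ge> k"
    by metis
  have "filterlim (\<lambda>k. period (Orb k)) at_top sequentially"
    by (rule filterlim_at_top_mono[OF filterlim_ident]) (simp add: Orb(3))
  moreover have "r ^ CARD('n) * r > 0" using r by simp
  ultimately show ?thesis using Orb(1,2) by blast
qed

end
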